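(* Let $p$ be a binary word of length $l$ with at most $3$ runs. (1) If $p$ is alternating, then $p$ has no internal zero at any $n\ge7$. (2) If $p$ is not alternating, then for every $n\ge l+3$ we have $B_{n,p}(M_{n,p}-1)=0$, and in particular $p$ has an internal zero at every $n\ge l+3$. Moreover, among non-alternating $p$ with at most $3$ runs, $B_{l+2,p}(M_{l+2,p}-1)=0$ fails only for the words $p$ that are trivially equivalent to $1101$.
   Context: $c_p(w)$ is the number of occurrences of $p$ as a (not necessarily consecutive) subsequence of $w$; $B_{n,p}(k)$ is the number of binary words of length $n$ with $c_p(w)=k$; $M_{n,p}=\max\{c_p(w):w\in\{0,1\}^n\}$. A run is a maximal block of consecutive equal letters; a word is alternating if all its runs have size $1$. $p$ has an internal zero at $n$ if there exist $0\le k_1<k_2<k_3$ with $B_{n,p}(k_1)\ne0$, $B_{n,p}(k_2)=0$, $B_{n,p}(k_3)\ne0$. Words $p$ and $q$ are trivially equivalent if $q\in\{p,p^r,p^c,p^{rc}\}$, where $p^r$ is the reverse, $p^c$ is obtained by swapping $0\leftrightarrow1$, and $p^{rc}$ is the complement of the reverse. *)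

theory Defs
  imports Main
begin

(* Binary words are lists of bool; True encodes the letter 1, False the letter 0. *)

definition occ :: "bool list \<Rightarrow> bool list \<Rightarrow> nat" where
  "occ p w = card {I. I \<subseteq> {..<length w} \<and> card I = length p \<and> nths w I = p}"

definition B :: "nat \<Rightarrow> bool list \<Rightarrow> nat \<Rightarrow> nat" where
  "B n p k = card {w :: bool list. length w = n \<and> occ p w = k}"

definition M :: "nat \<Rightarrow> bool list \<Rightarrow> nat" where
  "M n p = Max {occ p w | w. length w = n}"

definition nruns :: "bool list \<Rightarrow> nat" where
  "nruns p = length (remdups_adj p)"

definition alternating :: "bool list \<Rightarrow> bool" where
  "alternating p \<longleftrightarrow> (\<forall>i. Suc i < length p \<longrightarrow> p ! i \<noteq> p ! Suc i)"

definition internal_zero :: "bool list \<Rightarrow> nat \<Rightarrow> bool" where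
  "internal_zero p n \<longleftrightarrow> (\<exists>k1 k2 k3. k1 < k2 \<and> k2 < k3 \<and>
      B n p k1 \<noteq> 0 \<and> B n p k2 = 0 \<and> B n p k3 \<noteq> 0)"

definition compl_word :: "bool list \<Rightarrow> bool list" where
  "compl_word p = map Not p"

definition triv_equiv :: "bool list \<Rightarrow> bool list \<Rightarrow> bool" where
  "triv_equiv p q \<longleftrightarrow> q \<in> {p, rev p, compl_word p, compl_word (rev p)}"

end

theory Submission
  imports Defs
begin

text \<open>
  Up to complement \<open>p = 1\<^sup>a 0\<^sup>b 1\<^sup>c\<close> or \<open>p = 1\<^sup>a\<close>. Let a word have \<open>N\<close> ones and \<open>m\<close> zeros, the
  \<open>i\<close>-th zero being preceded by \<open>r\<^sub>i\<close> and followed by \<open>s\<^sub>i\<close> ones. Choosing the zeros of an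
  occurrence first, the number of occurrences is the sum of \<open>(r choose a) (s choose c)\<close> over the
  \<open>b\<close>-sets of zeros, with \<open>r\<close> taken at the first and \<open>s\<close> at the last zero of the set. So it is at
  most \<open>(m choose b) V\<close>, where \<open>V\<close> is the maximum of \<open>(x choose a) (N - x choose c)\<close>, and \<open>M\<close> is
  the maximum of \<open>(x choose a) (y choose b) (z choose c)\<close> over \<open>x + y + z = n\<close>.

  If such a product is not maximal, then log-concavity shows that moving one unit from one of \<open>x\<close>,
  \<open>y\<close>, \<open>z\<close> to another increases it. If it equals \<open>M - 1\<close>, then the factor that does not move
  divides \<open>M\<close> and \<open>M - 1\<close>, so it is 1, and the gain of exactly 1 in the other two forces
  \<open>n \<le> a + b + c + 1\<close>. If \<open>M - 1\<close> is instead attained by a word below the bound \<open>(m choose b) V\<close>, then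
  exactly one set of zeros has deficit 1, which is impossible except for 1101 and 1011 with \<open>n = 6\<close>.

  For \<open>p = 101\<close> and \<open>N = 2 h\<close> ones, the attained numbers are \<open>m h\<^sup>2\<close> minus sums of \<open>m\<close> squares of
  numbers up to \<open>h\<close>. Taking \<open>m\<close> close to \<open>h\<close> reaches everything between the maxima for \<open>n - 1\<close> and
  \<open>n\<close> when \<open>n \<ge> 12\<close>; smaller \<open>n\<close> are covered by explicit tables.
\<close>

section \<open>Occurrences as sums over sets of zeros\<close>

text \<open>Subsets are split by whether they contain 0, and the remainder is shifted down; this is
  the shape of a recursion on the first entry of a list.\<close>

lemma sum_Pow_lessThan_Suc:
  fixes g :: "nat set \<Rightarrow> nat"
  shows "(\<Sum>T\<in>Pow {..<Suc m}. g T)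
    = (\<Sum>T\<in>Pow {..<m}. g (Suc ` T)) + (\<Sum>T\<in>Pow {..<m}. g (insert 0 (Suc ` T)))"
proof -
  have P: "Pow {..<Suc m} = image Suc ` Pow {..<m} \<union> (\<lambda>T. insert 0 (Suc ` T)) ` Pow {..<m}"
    unfolding lessThan_Suc_eq_insert_0 Pow_insert by (auto simp: image_image subset_image_iff)
  have "(\<Sum>T\<in>Pow {..<Suc m}. g T) = sum g (image Suc ` Pow {..<m})
      + sum g ((\<lambda>T. insert 0 (Suc ` T)) ` Pow {..<m})"
    unfolding P by (rule sum.union_disjoint) auto
  moreover have "inj_on (image Suc) (Pow {..<m})"
    by (simp add: inj_on_def inj_image_eq_iff)
  moreover have "inj_on (\<lambda>T. insert 0 (Suc ` T)) (Pow {..<m})"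
  proof (rule inj_onI)
    fix S T :: "nat set" assume "insert 0 (Suc ` S) = insert 0 (Suc ` T)"
    then have "Suc ` S = Suc ` T" by (metis insert_ident zero_notin_Suc_image)
    then show "S = T" by (simp add: inj_image_eq_iff)
  qed
  ultimately show ?thesis by (simp add: sum.reindex)
qed

text \<open>A set of positions inside \<open>w\<close> has as many elements as
  \<open>nths w I\<close> has letters, so the cardinality condition of \<open>occ\<close> follows
  from \<open>nths w I = p\<close>.\<close>

lemma occ_conv_sum: "occ p w = (\<Sum>T\<in>Pow {..<length w}. of_bool (nths w T = p))"
proof -
  have "{I. I \<subseteq> {..<length w} \<and> card I = length p \<and> nths w I = p}
      = {I \<in> Pow {..<length w}. nths w I = p}"
  proof -
    have "card I = length (nths w I)" if "I \<subseteq> {..<length w}" for I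
      using that by (auto simp: length_nths intro!: arg_cong[where f = card])
    then show ?thesis by auto
  qed
  then show ?thesis
    by (simp add: occ_def of_bool_def sum.If_cases Int_def)
qed

lemma occ_Nil [simp]: "occ [] w = 1"
proof -
  have "{I. I \<subseteq> {..<length w} \<and> card I = 0 \<and> nths w I = []} = {{}}"
    by (auto dest: finite_subset)
  then show ?thesis by (simp add: occ_def)
qed

lemma occ_Cons_Nil [simp]: "occ (x # p) [] = 0"
  by (simp add: occ_conv_sum)

text \<open>An occurrence either avoids the first letter of the word or begins with it. The
  inductions over words below rest on this recursion.\<close>

lemma occ_Cons_Cons [simp]:
  "occ (x # p) (y # w) = occ (x # p) w + (if x = y then occ p w else 0)"
proof -
  have [simp]: "nths (y # w) (Suc ` T) = nths w T"
    "nths (y # w) (insert 0 (Suc ` T)) = y # nths w T" for T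
    by (auto simp: nths_Cons inj_image_mem_iff)
  show ?thesis
    by (auto simp: occ_conv_sum sum_Pow_lessThan_Suc)
qed

lemma occ_compl: "occ (compl_word p) (compl_word w) = occ p w"
  unfolding compl_word_def
proof (induction w arbitrary: p)
  case Nil then show ?case by (cases p) auto
next
  case (Cons y w)
  show ?case
  proof (cases p)
    case (Cons x q)
    then show ?thesis using Cons.IH[of p] Cons.IH[of q] by auto
  qed auto
qed

lemma occ_replicate_same: "occ (replicate a x) w = count_list w x choose a"
proof (induction w arbitrary: a)
  case Nil then show ?case by (cases a) auto
next
  case (Cons y w)
  show ?case
  proof (cases a)
    case (Suc k)
    then show ?thesis using Cons[of a] Cons[of k] by auto
  qed auto
qed

text \<open>One entry per zero, from left to right: the numbers of ones before and after it. So
  \<open>length (gaps w)\<close> is the number of zeros.\<close>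

fun gaps :: "bool list \<Rightarrow> (nat \<times> nat) list" where
  "gaps [] = []"
| "gaps (True # w) = map (apfst Suc) (gaps w)"
| "gaps (False # w) = (0, count_list w True) # gaps w"

lemma length_gaps: "length (gaps w) + count_list w True = length w"
  by (induction w rule: gaps.induct) auto

lemma gaps_nth_sum: "i < length (gaps w) \<Longrightarrow> fst (gaps w ! i) + snd (gaps w ! i) = count_list w True"
proof (induction w arbitrary: i rule: gaps.induct)
  case (3 w) then show ?case by (cases i) auto
qed auto

lemma gaps_nth_mono: "i \<le> j \<Longrightarrow> j < length (gaps w) \<Longrightarrow> fst (gaps w ! i) \<le> fst (gaps w ! j)"
proof (induction w arbitrary: i j rule: gaps.induct)
  case (3 w) then show ?case by (cases i; cases j) auto
qed auto

text \<open>For nonempty \<open>T\<close>, the number of occurrences of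
  \<open>three_runs a (card T) c\<close> whose zeros are those indexed by \<open>T\<close>: the
  outer blocks are chosen freely among the ones before the first and after the last of them.\<close>

definition gap_weight :: "nat \<Rightarrow> nat \<Rightarrow> (nat \<times> nat) list \<Rightarrow> nat set \<Rightarrow> nat" where
  "gap_weight a c zs T = (fst (zs ! Min T) choose a) * (snd (zs ! Max T) choose c)"

text \<open>The sum runs over a whole power set so that \<open>sum_Pow_lessThan_Suc\<close> applies;
  \<open>gap_sum_alt\<close> is the restricted form.\<close>

definition gap_sum :: "nat \<Rightarrow> nat \<Rightarrow> nat \<Rightarrow> (nat \<times> nat) list \<Rightarrow> nat" where
  "gap_sum a b c zs = (\<Sum>T\<in>Pow {..<length zs}. if card T = b then gap_weight a c zs T else 0)"

lemma gap_weight_Suc_image: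
  assumes "T \<noteq> {}" "T \<subseteq> {..<length zs}"
  shows "gap_weight a c (z # zs) (Suc ` T) = gap_weight a c zs T"
proof -
  have "finite T" using assms finite_subset by blast
  then show ?thesis
    using assms mono_Min_commute[of Suc T, symmetric] mono_Max_commute[of Suc T, symmetric]
    by (simp add: gap_weight_def mono_def)
qed

lemma gap_weight_insert_0:
  assumes "T \<subseteq> {..<length zs}"
  shows "gap_weight a c (z # zs) (insert 0 (Suc ` T))
    = (fst z choose a) * (if T = {} then snd z choose c else snd (zs ! Max T) choose c)"
proof -
  have "finite T" using assms finite_subset by blast
  then show ?thesis
    using mono_Max_commute[of Suc T, symmetric]
    by (auto simp: gap_weight_def mono_def Min_insert2)
qed

text \<open>If the first zero is chosen, it is the minimum, so its binomial factors out and the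
  other chosen zeros only carry the condition on the right, whence the parameter 0. For
  \<open>b = 1\<close> it is the maximum as well.\<close>

lemma gap_sum_Cons:
  assumes "b \<noteq> 0"
  shows "gap_sum a b c (z # zs) = gap_sum a b c zs
    + (fst z choose a) * (if b = 1 then snd z choose c else gap_sum 0 (b - 1) c zs)"
proof -
  have fin: "finite T" if "T \<subseteq> {..<length zs}" for T
    using that finite_subset by blast
  have "(\<Sum>T\<in>Pow {..<length zs}. if card (Suc ` T) = b then gap_weight a c (z # zs) (Suc ` T) else 0)
     = gap_sum a b c zs"
    unfolding gap_sum_def
    by (rule sum.cong) (use assms in \<open>auto simp: card_image gap_weight_Suc_image intro!: gap_weight_Suc_image\<close>)
  moreover have "(\<Sum>T\<in>Pow {..<length zs}. if card (insert 0 (Suc ` T)) = b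
        then gap_weight a c (z # zs) (insert 0 (Suc ` T)) else 0)
     = (fst z choose a) * (if b = 1 then snd z choose c else gap_sum 0 (b - 1) c zs)"
  proof (cases "b = 1")
    case True
    have "(\<Sum>T\<in>Pow {..<length zs}. if card (insert 0 (Suc ` T)) = b
        then gap_weight a c (z # zs) (insert 0 (Suc ` T)) else 0)
      = (\<Sum>T\<in>Pow {..<length zs}. if T = {} then (fst z choose a) * (snd z choose c) else 0)"
      by (rule sum.cong) (use True fin in \<open>auto simp: card_image gap_weight_insert_0 gap_weight_def\<close>)
    then show ?thesis using True by (simp add: gap_weight_def)
  next
    case False
    have "gap_weight a c (z # zs) (insert 0 (Suc ` T)) = (fst z choose a) * gap_weight 0 c zs T"
      if "T \<subseteq> {..<length zs}" "T \<noteq> {}" for T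
      using that gap_weight_insert_0[of T zs a c z] by (simp add: gap_weight_def[of 0])
    moreover have "T \<noteq> {}" if "card T = b - 1" for T :: "nat set"
      using that False assms by auto
    ultimately show ?thesis
      unfolding gap_sum_def using False assms fin
      by (auto simp: sum_distrib_left card_image intro!: sum.cong)
  qed
  ultimately show ?thesis
    unfolding gap_sum_def[of a b c "z # zs"] by (simp add: sum_Pow_lessThan_Suc del: card_insert_if)
qed

text \<open>A one put in front of the word raises all left counts by one; the second equation is
  Pascal's rule in each weight.\<close>

lemma gap_sum_map_Suc:
  assumes "b \<noteq> 0"
  shows "gap_sum 0 b c (map (apfst Suc) zs) = gap_sum 0 b c zs"
    and "gap_sum (Suc a) b c (map (apfst Suc) zs) = gap_sum (Suc a) b c zs + gap_sum a b c zs"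
proof -
  have mem: "Min T < length zs" "Max T < length zs"
    if "T \<subseteq> {..<length zs}" "card T = b" for T
  proof -
    have "T \<noteq> {}" "finite T" using that assms finite_subset by auto
    then have "Min T \<in> T" "Max T \<in> T" by auto
    then show "Min T < length zs" "Max T < length zs" using that by auto
  qed
  show "gap_sum 0 b c (map (apfst Suc) zs) = gap_sum 0 b c zs"
    unfolding gap_sum_def by (rule sum.cong) (auto simp: gap_weight_def mem)
  show "gap_sum (Suc a) b c (map (apfst Suc) zs) = gap_sum (Suc a) b c zs + gap_sum a b c zs"
    unfolding gap_sum_def sum.distrib[symmetric]
    by (rule sum.cong) (auto simp: gap_weight_def mem add_mult_distrib)
qed

definition three_runs :: "nat \<Rightarrow> nat \<Rightarrow> nat \<Rightarrow> bool list" where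
  "three_runs a b c = replicate a True @ replicate b False @ replicate c True"

text \<open>Both sides obey the same recursion in the first letter: \<open>gap_sum_map_Suc\<close>
  for a leading one, \<open>gap_sum_Cons\<close> for a leading zero.\<close>

lemma occ_three_runs:
  "b \<noteq> 0 \<Longrightarrow> occ (three_runs a b c) w = gap_sum a b c (gaps w)"
  unfolding three_runs_def
proof (induction w arbitrary: a b rule: gaps.induct)
  case 1
  then show ?case by (cases a; cases b) (auto simp: gap_sum_def)
next
  case (2 w)
  show ?case
  proof (cases a)
    case 0
    then show ?thesis using 2 "2.IH"[of b 0] by (cases b) (auto simp: gap_sum_map_Suc)
  next
    case (Suc k)
    then show ?thesis using 2 "2.IH"[of b a] "2.IH"[of b k] by (auto simp: gap_sum_map_Suc)
  qed
next
  case (3 w)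
  then obtain d where d: "b = Suc d" by (cases b) auto
  show ?case
  proof (cases a)
    case 0
    then show ?thesis
      using d "3.IH"[of b 0] "3.IH"[of d 0]
      by (cases d) (auto simp: gap_sum_Cons occ_replicate_same)
  next
    case (Suc k)
    then show ?thesis using 3 "3.IH"[of b a] by (auto simp: gap_sum_Cons)
  qed
qed

lemma gap_sum_alt:
  "gap_sum a b c zs = (\<Sum>T | T \<subseteq> {..<length zs} \<and> card T = b. gap_weight a c zs T)"
  unfolding gap_sum_def by (subst sum.inter_filter[symmetric]) (auto intro!: sum.cong)

lemma gap_sum_1: "gap_sum a 1 c zs = (\<Sum>(r, s)\<leftarrow>zs. (r choose a) * (s choose c))"
proof (induction zs)
  case Nil then show ?case by (auto simp: gap_sum_def)
next
  case (Cons z zs) then show ?case using gap_sum_Cons[of 1 a c z zs] by (cases z) simp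
qed

section \<open>Attained values, the maximum, and words made of three blocks\<close>

lemma finite_words: "finite {w :: bool list. length w = n}"
  using finite_lists_length_eq[of "UNIV :: bool set" n] by simp

lemma occ_le_M: "occ p w \<le> M (length w) p"
proof -
  have "{occ p w | w. length w = n} = occ p ` {w. length w = n}" for n by auto
  then show ?thesis unfolding M_def using finite_words by (intro Max_ge) auto
qed

lemma M_attained: "\<exists>w. length w = n \<and> occ p w = M n p"
proof -
  have *: "{occ p w | w. length w = n} = occ p ` {w. length w = n}" by auto
  have "replicate n True \<in> {w. length w = n}" by simp
  then have "M n p \<in> occ p ` {w. length w = n}"
    unfolding M_def * using finite_words by (intro Max_in) blast+
  then show ?thesis by auto
qed

lemma B_neq_0_iff: "B n p k \<noteq> 0 \<longleftrightarrow> (\<exists>w. length w = n \<and> occ p w = k)"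
proof -
  have "finite {w :: bool list. length w = n \<and> occ p w = k}"
    using finite_words[of n] by (rule rev_finite_subset) auto
  then show ?thesis by (auto simp: B_def)
qed

lemma count_list_replicate_same: "count_list (replicate n x) x = n"
  by (induction n) auto

lemma gaps_three_runs: "gaps (three_runs x y z) = replicate y (x, z)"
  unfolding three_runs_def
proof (induction x)
  case 0
  have "gaps (replicate z True) = []" by (induction z) auto
  then have "gaps (replicate y False @ replicate z True) = replicate y (0, z)"
    by (induction y) (auto simp: count_list_replicate_same)
  then show ?case by simp
qed (auto simp: map_replicate)

text \<open>All zeros of a block word have the same gap, so all \<open>b\<close>-sets of zeros have
  the same weight. Such words supply every lower bound on \<open>M\<close> below.\<close>

lemma occ_three_runs_three_runs:
  assumes "b \<noteq> 0"
  shows "occ (three_runs a b c) (three_runs x y z) = (x choose a) * (y choose b) * (z choose c)"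
proof -
  have "gap_weight a c (replicate y (x, z)) T = (x choose a) * (z choose c)"
    if "T \<subseteq> {..<y}" "card T = b" for T
  proof -
    have "T \<noteq> {}" "finite T" using that assms finite_subset by auto
    then have "Min T \<in> T" "Max T \<in> T" by auto
    then have "Min T < y" "Max T < y" using that(1) by blast+
    then show ?thesis by (simp add: gap_weight_def)
  qed
  then have "occ (three_runs a b c) (three_runs x y z)
    = (\<Sum>T | T \<subseteq> {..<y} \<and> card T = b. (x choose a) * (z choose c))"
    unfolding occ_three_runs[OF assms] gaps_three_runs gap_sum_alt by (intro sum.cong) auto
  also have "\<dots> = (x choose a) * (y choose b) * (z choose c)"
    using n_subsets[of "{..<y}" b] by simp
  finally show ?thesis .
qed

section \<open>Exchange arguments for products of binomial coefficients\<close>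

text \<open>Multiplied by \<open>(Suc x - a) * (Suc y - b)\<close>, both sides become multiples of
  \<open>(x choose a) * (y choose b)\<close> by absorption; cancelling this leaves a linear
  inequality.\<close>

lemma exchange_le_iff:
  fixes a b x y :: nat
  assumes "a \<le> x" "b \<le> y"
  shows "(Suc x choose a) * (y choose b) \<le> (x choose a) * (Suc y choose b)
    \<longleftrightarrow> a * Suc y \<le> b * Suc x"
proof -
  define u v where "u = Suc x - a" and "v = Suc y - b"
  have uv: "u > 0" "v > 0" "Suc x = u + a" "Suc y = v + b" using assms by (auto simp: u_def v_def)
  have x: "u * (Suc x choose a) = Suc x * (x choose a)" and y: "v * (Suc y choose b) = Suc y * (y choose b)"
    using binomial_absorb_comp[of "Suc x" a] binomial_absorb_comp[of "Suc y" b]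
    by (simp_all add: u_def v_def)
  let ?Q = "(x choose a) * (y choose b)"
  have Q: "?Q > 0" using assms by simp
  have "(Suc x choose a) * (y choose b) \<le> (x choose a) * (Suc y choose b)
    \<longleftrightarrow> (u * v) * ((Suc x choose a) * (y choose b)) \<le> (u * v) * ((x choose a) * (Suc y choose b))"
    using uv by simp
  also have "(u * v) * ((Suc x choose a) * (y choose b)) = (u * (Suc x choose a)) * (v * (y choose b))"
    by (simp only: ac_simps)
  also have "\<dots> = ?Q * (Suc x * v)"
    unfolding x by (simp only: ac_simps)
  also have "(u * v) * ((x choose a) * (Suc y choose b)) = (v * (Suc y choose b)) * (u * (x choose a))"
    by (simp only: ac_simps)
  also have "\<dots> = ?Q * (Suc y * u)"
    unfolding y by (simp only: ac_simps)
  also have "?Q * (Suc x * v) \<le> ?Q * (Suc y * u) \<longleftrightarrow> Suc x * v \<le> Suc y * u"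
    using Q by simp
  also have "\<dots> \<longleftrightarrow> a * Suc y \<le> b * Suc x"
    unfolding uv by (simp add: algebra_simps)
  finally show ?thesis .
qed

text \<open>This binomial is the growth of \<open>x choose a\<close> when \<open>x\<close> rises by
  one. It equals \<open>a\<close> at \<open>x = a\<close> and increases strictly from there if
  \<open>a\<close> is at least 2.\<close>

lemma choose_pred_ge:
  fixes a x :: nat
  assumes "1 \<le> a" "a \<le> x"
  shows "a \<le> x choose (a - 1)" and "x choose (a - 1) = a \<Longrightarrow> a = 1 \<or> x = a"
proof -
  have a: "a choose (a - 1) = a" using assms by (metis binomial_symmetric choose_one diff_diff_cancel)
  show "a \<le> x choose (a - 1)" using binomial_right_mono[of a x "a - 1"] a assms by simp
  show "a = 1 \<or> x = a" if "x choose (a - 1) = a"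
  proof (rule ccontr)
    assume "\<not> ?thesis"
    then obtain y where y: "x = Suc y" "a \<le> y" "a \<ge> 2" using assms by (cases x) auto
    then have "x choose (a - 1) = (y choose (a - 1)) + (y choose (a - 2))"
      using choose_reduce_nat[of x "a - 1"] by (simp add: numeral_2_eq_2)
    moreover have "y choose (a - 2) > 0" using y by simp
    moreover have "a \<le> y choose (a - 1)" using binomial_right_mono[of a y "a - 1"] a y by simp
    ultimately show False using that by linarith
  qed
qed

text \<open>With the growths \<open>A\<close> and \<open>B\<close> of the two binomials, the
  equation scaled by \<open>a * b\<close> reads \<open>A * B * (a * v - b * u) = a * b\<close>.
  Since \<open>A\<close> is at least \<open>a\<close> and \<open>B\<close> at least
  \<open>b\<close>, both are equalities and \<open>a * v = b * u + 1\<close>. The equality cases of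
  \<open>choose_pred_ge\<close> then leave four small cases.\<close>

lemma exchange_gain_one:
  fixes a b x y :: nat
  assumes "1 \<le> a" "1 \<le> b" "a \<le> x"
    and gain: "(Suc x choose a) * (y choose b) = (x choose a) * (Suc y choose b) + 1"
  shows "a = 1 \<and> b = 1 \<and> y = Suc x \<or> x = a \<and> y = b \<and> a = Suc b"
proof -
  have "b \<le> y"
  proof (rule ccontr)
    assume "\<not> b \<le> y"
    then show False using gain by (simp add: binomial_eq_0)
  qed
  define u v where "u = Suc x - a" and "v = Suc y - b"
  have uv: "Suc x = u + a" "Suc y = v + b" using assms \<open>b \<le> y\<close> by (auto simp: u_def v_def)
  define A B where "A = x choose (a - 1)" and "B = y choose (b - 1)"
  have x: "a * (x choose a) = u * A" and y: "b * (y choose b) = v * B"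
  proof -
    have *: "k * (n choose k) = (Suc n - k) * (n choose (k - 1))" if "1 \<le> k" for n k :: nat
      using times_binomial_minus1_eq[of k n] binomial_absorb_comp[of n "k - 1"] that by simp
    show "a * (x choose a) = u * A" "b * (y choose b) = v * B"
      unfolding A_def B_def u_def v_def using * assms by blast+
  qed
  have sx: "Suc x choose a = (x choose a) + A" and sy: "Suc y choose b = (y choose b) + B"
    using choose_reduce_nat[of "Suc x" a] choose_reduce_nat[of "Suc y" b] assms
    by (simp_all add: A_def B_def)
  have AB: "a \<le> A" "b \<le> B" using choose_pred_ge(1) assms \<open>b \<le> y\<close> by (auto simp: A_def B_def)
  have "A * (y choose b) = (x choose a) * B + 1"
    using gain unfolding sx sy by (simp add: algebra_simps)
  then have "a * A * (b * (y choose b)) = (a * (x choose a)) * (b * B) + a * b"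
  proof -
    assume *: "A * (y choose b) = (x choose a) * B + 1"
    have "a * A * (b * (y choose b)) = a * b * (A * (y choose b))" by (simp only: ac_simps)
    also have "\<dots> = (a * (x choose a)) * (b * B) + a * b" unfolding * by (simp add: algebra_simps)
    finally show ?thesis .
  qed
  then have eq: "(A * B) * (a * v) = (A * B) * (b * u) + a * b"
    unfolding x y by (simp only: ac_simps)
  have "a * b \<le> A * B" using AB by (rule mult_le_mono)
  have "b * u < a * v"
  proof (rule ccontr)
    assume "\<not> b * u < a * v"
    then have "(A * B) * (a * v) \<le> (A * B) * (b * u)" by simp
    then show False using eq assms by simp
  qed
  then obtain K where K: "a * v = b * u + Suc K" using less_iff_Suc_add by auto
  have "(A * B) * Suc K = a * b"
    using eq unfolding K by (simp add: algebra_simps)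
  then have "A * B + A * B * K = a * b" by simp
  moreover have "0 < A * B" using AB assms(1,2) by simp
  ultimately have "A * B * K = 0" "K = 0"
    using \<open>a * b \<le> A * B\<close> by (linarith, metis add_le_same_cancel1 le_0_eq mult_is_0 not_gr_zero)
  then have eqAB: "A * B = a * b" using \<open>A * B + A * B * K = a * b\<close> by simp
  have "A * b \<le> A * B" "a * B \<le> A * B" using AB by (auto intro: mult_le_mono)
  then have "A \<le> a" "B \<le> b"
    unfolding eqAB using assms(1,2) by (auto simp: mult.commute)
  with AB have "A = a" "B = b" by auto
  have "a * v = Suc (b * u)" using K \<open>K = 0\<close> by simp
  have "a = 1 \<or> x = a" "b = 1 \<or> y = b"
    using choose_pred_ge(2) assms \<open>b \<le> y\<close> \<open>A = a\<close> \<open>B = b\<close> by (auto simp: A_def B_def)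
  moreover have "a * Suc y = Suc (b * Suc x)"
    unfolding uv using \<open>a * v = Suc (b * u)\<close> by (simp add: algebra_simps)
  ultimately have eq': "a * Suc y = Suc (b * Suc x)" and
    "(a = 1 \<and> b = 1) \<or> (a = 1 \<and> y = b) \<or> (x = a \<and> b = 1) \<or> (x = a \<and> y = b)"
    by blast+
  then consider "a = 1" "b = 1" | "a = 1" "y = b" | "x = a" "b = 1" | "x = a" "y = b" by blast
  then show ?thesis
  proof cases
    case 1
    with eq' show ?thesis by simp
  next
    case 2
    with eq' assms(1-3) show ?thesis by simp
  next
    case 3
    \<comment> \<open>The solution \<open>a = 1\<close> belongs to the first alternative,
      \<open>a = 2\<close> to the second.\<close>
    with eq' have "a * y = 2" by simp
    then have "a \<le> 2" by (metis dvd_imp_le dvd_triv_left zero_less_numeral)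
    with assms(1) have "a = 1 \<or> a = 2" by linarith
    then show ?thesis using 3 \<open>a * y = 2\<close> by auto
  next
    case 4
    with eq' show ?thesis by (simp add: mult.commute)
  qed
qed

text \<open>This isolates the two factors that an exchange changes; with the old values for
  \<open>s\<close> and \<open>t\<close> it also splits the original product and sum.\<close>

lemma prod_choose_upd2:
  fixes a x :: "'i \<Rightarrow> nat"
  assumes "finite I" "i \<in> I" "j \<in> I" "i \<noteq> j"
  shows "(\<Prod>k\<in>I. (x(i := s, j := t)) k choose a k)
    = (s choose a i) * (t choose a j) * (\<Prod>k\<in>I - {i, j}. x k choose a k)"
    and "(\<Sum>k\<in>I. (x(i := s, j := t)) k) = s + t + (\<Sum>k\<in>I - {i, j}. x k)"
proof -
  have I: "I = insert i (insert j (I - {i, j}))" using assms by auto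
  have "(\<Prod>k\<in>I. (x(i := s, j := t)) k choose a k)
    = (\<Prod>k\<in>insert i (insert j (I - {i, j})). (x(i := s, j := t)) k choose a k)"
    using I by simp
  also have "\<dots> = (s choose a i) * (t choose a j) * (\<Prod>k\<in>I - {i, j}. (x(i := s, j := t)) k choose a k)"
    using assms by (subst prod.insert; simp)+
  also have "(\<Prod>k\<in>I - {i, j}. (x(i := s, j := t)) k choose a k) = (\<Prod>k\<in>I - {i, j}. x k choose a k)"
    by (rule prod.cong) auto
  finally show "(\<Prod>k\<in>I. (x(i := s, j := t)) k choose a k)
    = (s choose a i) * (t choose a j) * (\<Prod>k\<in>I - {i, j}. x k choose a k)" .
  have "(\<Sum>k\<in>I. (x(i := s, j := t)) k) = (\<Sum>k\<in>insert i (insert j (I - {i, j})). (x(i := s, j := t)) k)"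
    using I by simp
  also have "\<dots> = s + t + (\<Sum>k\<in>I - {i, j}. (x(i := s, j := t)) k)"
    using assms by (subst sum.insert; simp)+
  also have "(\<Sum>k\<in>I - {i, j}. (x(i := s, j := t)) k) = (\<Sum>k\<in>I - {i, j}. x k)"
    by (rule sum.cong) auto
  finally show "(\<Sum>k\<in>I. (x(i := s, j := t)) k) = s + t + (\<Sum>k\<in>I - {i, j}. x k)" .
qed

text \<open>Local optimality under exchanges is the linear condition of \<open>exchange_le_iff\<close>, which is
  stable under moving any competitor one unit towards \<open>x\<close>; so a local optimum is global.\<close>

lemma locally_optimal_imp_optimal:
  fixes a x y :: "'i \<Rightarrow> nat"
  assumes "finite I"
    and ax: "\<And>i. i \<in> I \<Longrightarrow> a i \<le> x i"
    and opt: "\<And>i j. i \<in> I \<Longrightarrow> j \<in> I \<Longrightarrow> i \<noteq> j \<Longrightarrow> a i * x j \<le> a j * Suc (x i)"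
    and "sum y I = sum x I"
  shows "(\<Prod>k\<in>I. y k choose a k) \<le> (\<Prod>k\<in>I. x k choose a k)"
  using \<open>sum y I = sum x I\<close>
\<comment> \<open>The measure is the total excess of \<open>y\<close> over \<open>x\<close>, by
  truncated subtraction; an exchange towards \<open>x\<close> lowers it.\<close>
proof (induction "\<Sum>k\<in>I. y k - x k" arbitrary: y rule: less_induct)
  case less
  show ?case
  proof (cases "(\<exists>k\<in>I. y k < a k) \<or> (\<forall>k\<in>I. y k = x k)")
    case True
    then show ?thesis
    proof
      assume "\<exists>k\<in>I. y k < a k"
      then have "(\<Prod>k\<in>I. y k choose a k) = 0" using \<open>finite I\<close> by (auto simp: prod_zero_iff)
      then show ?thesis by simp
    qed (simp cong: prod.cong)
  next
    case False
    then have ay: "a k \<le> y k" if "k \<in> I" for k using that by force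
    obtain i where i: "i \<in> I" "x i < y i"
      using False less.prems sum_strict_mono_ex1[OF \<open>finite I\<close>, of y x] by (metis less_irrefl not_le order_le_less)
    obtain j where j: "j \<in> I" "y j < x j"
      using False less.prems sum_strict_mono_ex1[OF \<open>finite I\<close>, of x y] by (metis less_irrefl not_le order_le_less)
    have "i \<noteq> j" using i j by auto
    obtain s where s: "y i = Suc s" using i by (cases "y i") auto
    define z where "z = y(i := s, j := Suc (y j))"
    have y: "y(i := Suc s, j := y j) = y" using s by auto
    have "sum z I = sum x I"
      using less.prems prod_choose_upd2(2)[OF \<open>finite I\<close> i(1) j(1) \<open>i \<noteq> j\<close>, of y s "Suc (y j)"]
        prod_choose_upd2(2)[OF \<open>finite I\<close> i(1) j(1) \<open>i \<noteq> j\<close>, of y "Suc s" "y j"]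
      unfolding y z_def by simp
    moreover have "(\<Sum>k\<in>I. z k - x k) < (\<Sum>k\<in>I. y k - x k)"
    proof (rule sum_strict_mono_ex1[OF \<open>finite I\<close>])
      show "\<forall>k\<in>I. z k - x k \<le> y k - x k" using i j s by (auto simp: z_def)
      show "\<exists>k\<in>I. z k - x k < y k - x k" using i j s \<open>i \<noteq> j\<close> by (intro bexI[of _ i]) (auto simp: z_def)
    qed
    ultimately have "(\<Prod>k\<in>I. z k choose a k) \<le> (\<Prod>k\<in>I. x k choose a k)" using less.hyps by blast
    moreover have "(\<Prod>k\<in>I. y k choose a k) \<le> (\<Prod>k\<in>I. z k choose a k)"
    proof -
      have "a i * Suc (y j) \<le> a i * x j" using j by (intro mult_le_mono2) simp
      also have "\<dots> \<le> a j * Suc (x i)" using opt i j \<open>i \<noteq> j\<close> by simp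
      also have "\<dots> \<le> a j * Suc s" using i s by simp
      finally have "(Suc s choose a i) * (y j choose a j) \<le> (s choose a i) * (Suc (y j) choose a j)"
        using exchange_le_iff[of "a i" s "a j" "y j"] ax[OF i(1)] ay[OF j(1)] i s by simp
      then show ?thesis
        using prod_choose_upd2(1)[OF \<open>finite I\<close> i(1) j(1) \<open>i \<noteq> j\<close>, of y s "Suc (y j)" a]
        prod_choose_upd2(1)[OF \<open>finite I\<close> i(1) j(1) \<open>i \<noteq> j\<close>, of y "Suc s" "y j" a]
        unfolding y z_def by simp
    qed
    ultimately show ?thesis by simp
  qed
qed

text \<open>As \<open>x\<close> is not optimal, some exchange improves it, by exactly 1 because of
  \<open>max\<close>. The product \<open>R\<close> of the untouched factors divides this gain, so
  \<open>R = 1\<close> and \<open>exchange_gain_one\<close> applies. The outcome is that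
  \<open>x\<close> exceeds \<open>a\<close> by one unit in total. The index set is arbitrary because
  two and three factors are both needed.\<close>

lemma prod_choose_max_minus_one:
  fixes a x y :: "'i \<Rightarrow> nat"
  assumes "finite I"
    and a: "\<And>i. i \<in> I \<Longrightarrow> 1 \<le> a i"
    and ax: "\<And>i. i \<in> I \<Longrightarrow> a i \<le> x i"
    and max: "\<And>z. sum z I = sum x I \<Longrightarrow> (\<Prod>k\<in>I. z k choose a k) \<le> Suc (\<Prod>k\<in>I. x k choose a k)"
    and y: "sum y I = sum x I" "(\<Prod>k\<in>I. y k choose a k) = Suc (\<Prod>k\<in>I. x k choose a k)"
    and ex: "\<exists>k\<in>I. a k \<noteq> 1"
  shows "\<exists>i\<in>I. \<exists>j\<in>I. i \<noteq> j \<and> (\<forall>k\<in>I - {i, j}. x k = a k) \<and> x i = a i \<and> x j = Suc (a j) \<and> a i = Suc (a j)"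
proof -
  obtain i j where ij: "i \<in> I" "j \<in> I" "i \<noteq> j" and nopt: "\<not> a i * x j \<le> a j * Suc (x i)"
  proof -
    have "\<not> (\<forall>i\<in>I. \<forall>j\<in>I. i \<noteq> j \<longrightarrow> a i * x j \<le> a j * Suc (x i))"
    proof
      assume "\<forall>i\<in>I. \<forall>j\<in>I. i \<noteq> j \<longrightarrow> a i * x j \<le> a j * Suc (x i)"
      then have "(\<Prod>k\<in>I. y k choose a k) \<le> (\<Prod>k\<in>I. x k choose a k)"
        using \<open>finite I\<close> ax y(1) by (intro locally_optimal_imp_optimal) auto
      then show False using y(2) by simp
    qed
    then show ?thesis using that by blast
  qed
  have "x j \<noteq> a j"
  proof
    assume "x j = a j"
    then have "a j * a i \<le> a j * Suc (x i)" using ax[OF ij(1)] by (intro mult_le_mono) auto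
    then show False using nopt \<open>x j = a j\<close> by (simp add: mult.commute)
  qed
  then obtain t where t: "x j = Suc t" "a j \<le> t" using ax[OF ij(2)] by (cases "x j") auto
  define R where "R = (\<Prod>k\<in>I - {i, j}. x k choose a k)"
  note upd = prod_choose_upd2[OF \<open>finite I\<close> ij, of x]
  have x: "x(i := x i, j := Suc t) = x" using t by auto
  have Px: "(\<Prod>k\<in>I. x k choose a k) = (x i choose a i) * (Suc t choose a j) * R"
    and Sx: "sum x I = x i + Suc t + (\<Sum>k\<in>I - {i, j}. x k)"
    using upd(1)[of "x i" "Suc t" a] upd(2)[of "x i" "Suc t"] unfolding x R_def by simp_all
  have "(x i choose a i) * (Suc t choose a j) < (Suc (x i) choose a i) * (t choose a j)"
    using exchange_le_iff[of "a i" "x i" "a j" t] nopt t ax[OF ij(1)] by simp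
  moreover have "R > 0" using ax unfolding R_def by (intro prod_pos) (simp add: Suc_le_eq)
  moreover have "(Suc (x i) choose a i) * (t choose a j) * R \<le> Suc ((x i choose a i) * (Suc t choose a j) * R)"
    using max[of "x(i := Suc (x i), j := t)"] upd(1)[of "Suc (x i)" t a] upd(2)[of "Suc (x i)" t]
    by (simp add: Px Sx R_def)
  moreover have "R = 1 \<and> q = p + 1" if "p < q" "R > 0" "q * R \<le> Suc (p * R)" for p q :: nat
  proof -
    have "Suc p * R \<le> q * R" using \<open>p < q\<close> by (intro mult_le_mono1) simp
    then have "R = 1" using that by simp
    then show ?thesis using that by simp
  qed
  ultimately have R: "R = 1" and
    gain: "(Suc (x i) choose a i) * (t choose a j) = (x i choose a i) * (Suc t choose a j) + 1"
    by blast+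
  have cases: "a i = 1 \<and> a j = 1 \<and> t = Suc (x i) \<or> x i = a i \<and> t = a j \<and> a i = Suc (a j)"
    using exchange_gain_one[OF a[OF ij(1)] a[OF ij(2)] ax[OF ij(1)] gain] .
  have rest: "x k = a k" if "k \<in> I - {i, j}" for k
  proof (rule ccontr)
    assume "x k \<noteq> a k"
    then have "a k < x k" using ax[of k] that by simp
    then have "Suc (a k) choose a k \<le> x k choose a k" by (intro binomial_right_mono) simp
    then have "2 \<le> x k choose a k" using a[of k] that by simp
    moreover have "(x k choose a k) dvd R" unfolding R_def using \<open>finite I\<close> that by (intro dvd_prodI) auto
    ultimately show False using R by simp
  qed
  from cases show ?thesis
  proof
    assume c: "a i = 1 \<and> a j = 1 \<and> t = Suc (x i)"
    obtain k where "k \<in> I" "a k \<noteq> 1" using ex by blast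
    then have k: "k \<in> I - {i, j}" "a k \<ge> 2" using c a[of k] by auto
    define S where "S = (\<Prod>k\<in>I - {i, j, k}. x k choose a k)"
    have Ik: "I - {i, j} = insert k (I - {i, j, k})" using k by auto
    have "R = (x k choose a k) * S"
      unfolding R_def S_def Ik using \<open>finite I\<close> by (subst prod.insert) auto
    then have "S = 1" using R by simp
    \<comment> \<open>Here \<open>x j = x i + 2\<close>. Two units leave \<open>j\<close>, one for
      \<open>i\<close> and one for \<open>k\<close>; the product becomes at least
      \<open>3 * x i * (x i + 1)\<close>, more than the allowed
      \<open>x i * (x i + 2) + 1\<close>.\<close>
    define x' where "x' = x(k := Suc (a k))"
    define z where "z = x'(i := Suc (x i), j := x i)"
    note upd' = prod_choose_upd2[OF \<open>finite I\<close> ij, of x' "Suc (x i)" "x i", folded z_def]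
    have "sum z I = Suc (x i) + x i + (Suc (a k) + (\<Sum>l\<in>I - {i, j, k}. x l))"
      unfolding upd'(2) Ik using \<open>finite I\<close> by (subst sum.insert) (auto simp: x'_def intro!: sum.cong)
    moreover have "sum x I = x i + Suc (Suc (x i)) + (a k + (\<Sum>l\<in>I - {i, j, k}. x l))"
      unfolding Sx Ik using \<open>finite I\<close> c rest[OF k(1)] by (subst sum.insert) auto
    ultimately have "sum z I = sum x I" by simp
    moreover have "(\<Prod>l\<in>I. z l choose a l) = Suc (x i) * x i * (Suc (a k) * S)"
      unfolding upd'(1) Ik using \<open>finite I\<close> c by (subst prod.insert) (auto simp: x'_def S_def intro!: prod.cong)
    ultimately have "Suc (x i) * x i * Suc (a k) \<le> Suc (Suc (Suc (x i)) * x i)"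
      using max[of z] Px c R t \<open>S = 1\<close> by (simp add: mult.commute)
    moreover have "Suc (x i) * x i * 3 \<le> Suc (x i) * x i * Suc (a k)"
      using k by (intro mult_le_mono2) simp
    moreover have "x i \<ge> 1" using ax[OF ij(1)] c by simp
    moreover have "x i * 1 \<le> x i * x i" using \<open>x i \<ge> 1\<close> by (intro mult_le_mono2) 
    ultimately have False by (simp add: algebra_simps)
    then show ?thesis ..
  next
    assume "x i = a i \<and> t = a j \<and> a i = Suc (a j)"
    then show ?thesis using ij rest t by (intro bexI[of _ i] bexI[of _ j]) auto
  qed
qed

section \<open>The value below the maximum\<close>

text \<open>The left counts do not decrease along the word, so at most
  \<open>count_list w True - r\<close> ones follow the last zero of \<open>T\<close>.\<close>

lemma gap_weight_le:
  assumes "T \<subseteq> {..<length (gaps w)}" "T \<noteq> {}"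
  defines "r \<equiv> fst (gaps w ! Min T)"
  shows "r \<le> count_list w True"
    and "gap_weight a c (gaps w) T \<le> (r choose a) * ((count_list w True - r) choose c)"
proof -
  have "finite T" using assms finite_subset by blast
  then have "Min T \<le> Max T" using assms(2) by simp
  have *: "Max T < length (gaps w)" "Min T < length (gaps w)"
    using \<open>finite T\<close> assms(1,2) Min_in[of T] Max_in[of T] by blast+
  show "r \<le> count_list w True" using gaps_nth_sum[OF *(2)] by (simp add: r_def)
  have "snd (gaps w ! Max T) \<le> count_list w True - r"
    using gaps_nth_mono[OF \<open>Min T \<le> Max T\<close> *(1)] gaps_nth_sum[OF *(1)] by (simp add: r_def)
  then show "gap_weight a c (gaps w) T \<le> (r choose a) * ((count_list w True - r) choose c)"
    unfolding gap_weight_def r_def by (intro mult_le_mono binomial_right_mono) auto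
qed

text \<open>This is the \<open>V\<close> of the overview: the largest weight that a single position
  among \<open>N\<close> ones can have.\<close>

definition best_split :: "nat \<Rightarrow> nat \<Rightarrow> nat \<Rightarrow> nat" where
  "best_split a c N = Max ((\<lambda>x. (x choose a) * ((N - x) choose c)) ` {..N})"

lemma best_split_ge: "x \<le> N \<Longrightarrow> (x choose a) * ((N - x) choose c) \<le> best_split a c N"
  unfolding best_split_def by (intro Max_ge) auto

lemma best_split_attained: "\<exists>x\<le>N. (x choose a) * ((N - x) choose c) = best_split a c N"
proof -
  have "best_split a c N \<in> (\<lambda>x. (x choose a) * ((N - x) choose c)) ` {..N}"
    unfolding best_split_def by (intro Max_in) auto
  then show ?thesis by auto
qed

lemma length_three_runs [simp]: "length (three_runs x y z) = x + y + z"
  by (simp add: three_runs_def)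

lemma M_ge_three_runs:
  assumes "b \<noteq> 0" "x + y + z = n"
  shows "(x choose a) * (y choose b) * (z choose c) \<le> M n (three_runs a b c)"
  using occ_le_M[of "three_runs a b c" "three_runs x y z"] assms
  by (simp add: occ_three_runs_three_runs)

lemma best_split_le_M:
  assumes "b \<noteq> 0" "m + N = n"
  shows "(m choose b) * best_split a c N \<le> M n (three_runs a b c)"
proof -
  obtain x where "x \<le> N" "(x choose a) * ((N - x) choose c) = best_split a c N"
    using best_split_attained by blast
  then show ?thesis using M_ge_three_runs[of b x m "N - x" n a c] assms by (simp add: ac_simps)
qed

lemma gap_weight_le_best_split:
  assumes "T \<subseteq> {..<length (gaps w)}" "T \<noteq> {}"
  shows "gap_weight a c (gaps w) T \<le> best_split a c (count_list w True)"
  using gap_weight_le[OF assms] best_split_ge le_trans by blast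

lemma occ_le_best_split:
  assumes "b \<noteq> 0"
  shows "occ (three_runs a b c) w \<le> (length (gaps w) choose b) * best_split a c (count_list w True)"
proof -
  have "gap_sum a b c (gaps w) \<le> (\<Sum>T | T \<subseteq> {..<length (gaps w)} \<and> card T = b. best_split a c (count_list w True))"
    unfolding gap_sum_alt by (intro sum_mono gap_weight_le_best_split) (use assms in auto)
  then show ?thesis
    using n_subsets[of "{..<length (gaps w)}" b] by (simp add: occ_three_runs[OF assms])
qed

text \<open>The deficits of the individual \<open>b\<close>-sets are natural numbers with sum
  1.\<close>

lemma occ_deficit_one:
  assumes "b \<noteq> 0"
    and "Suc (occ (three_runs a b c) w) = (length (gaps w) choose b) * best_split a c (count_list w True)"
  obtains T where "T \<subseteq> {..<length (gaps w)}" "card T = b"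
    "Suc (gap_weight a c (gaps w) T) = best_split a c (count_list w True)"
    "\<And>U. U \<subseteq> {..<length (gaps w)} \<Longrightarrow> card U = b \<Longrightarrow> U \<noteq> T \<Longrightarrow>
      gap_weight a c (gaps w) U = best_split a c (count_list w True)"
proof -
  define \<A> where "\<A> = {T. T \<subseteq> {..<length (gaps w)} \<and> card T = b}"
  define V where "V = best_split a c (count_list w True)"
  let ?g = "gap_weight a c (gaps w)"
  have fin: "finite \<A>" by (auto simp: \<A>_def)
  have le: "?g T \<le> V" if "T \<in> \<A>" for T
    using that assms(1) gap_weight_le_best_split[of T w a c] by (cases "T = {}") (auto simp: \<A>_def V_def)
  have "(\<Sum>T\<in>\<A>. ?g T) + (\<Sum>T\<in>\<A>. V - ?g T) = (\<Sum>T\<in>\<A>. V)"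
    unfolding sum.distrib[symmetric] using le by (intro sum.cong) auto
  also have "\<dots> = Suc (\<Sum>T\<in>\<A>. ?g T)"
    using assms(2) n_subsets[of "{..<length (gaps w)}" b]
    by (simp add: occ_three_runs[OF assms(1)] gap_sum_alt \<A>_def V_def)
  finally have "(\<Sum>T\<in>\<A>. V - ?g T) = Suc 0" by simp
  then obtain T where T: "T \<in> \<A>" "V - ?g T = Suc 0" "\<forall>U\<in>\<A>. T \<noteq> U \<longrightarrow> V - ?g U = 0"
    using iffD1[OF sum_eq_Suc0_iff[OF fin]] by meson
  show ?thesis
  proof (rule that)
    show "T \<subseteq> {..<length (gaps w)}" "card T = b" using T(1) by (auto simp: \<A>_def)
    show "Suc (?g T) = best_split a c (count_list w True)" using T(2) by (simp add: V_def)
    show "?g U = best_split a c (count_list w True)"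
      if "U \<subseteq> {..<length (gaps w)}" "card U = b" "U \<noteq> T" for U
    proof -
      have "U \<in> \<A>" using that by (simp add: \<A>_def)
      then show ?thesis using le[of U] T(3) that(3) by (auto simp: V_def)
    qed
  qed
qed

text \<open>A maximal word reaches the bound \<open>occ_le_best_split\<close>, and a block word with
  as many zeros and ones reaches it too. So \<open>M\<close> is a maximum of products.\<close>

lemma M_three_runs_attained:
  assumes "b \<noteq> 0"
  obtains x y z where "x + y + z = n" "(x choose a) * (y choose b) * (z choose c) = M n (three_runs a b c)"
proof -
  obtain w where w: "length w = n" "occ (three_runs a b c) w = M n (three_runs a b c)"
    using M_attained by blast
  let ?m = "length (gaps w)" and ?N = "count_list w True"
  have n: "?m + ?N = n" using length_gaps w(1) by simp
  obtain x where x: "x \<le> ?N" "(x choose a) * ((?N - x) choose c) = best_split a c ?N"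
    using best_split_attained by blast
  have "M n (three_runs a b c) = (?m choose b) * best_split a c ?N"
    using occ_le_best_split[OF assms, of a c w] best_split_le_M[OF assms n, of a c] w(2) by simp
  with x n show ?thesis
    by (intro that[of x ?m "?N - x"]) (auto simp: ac_simps)
qed

text \<open>Otherwise \<open>prod_choose_max_minus_one\<close> would give
  \<open>x + y + z = a + b + c + 1\<close>, against the lower bound on \<open>n\<close>. The
  function \<open>f\<close> in the proof encodes triples over the index set
  \<open>{0, 1, 2}\<close>.\<close>

lemma three_prod_neq_M_minus_one:
  assumes "1 \<le> a" "1 \<le> b" "1 \<le> c" "\<not> (a = 1 \<and> b = 1 \<and> c = 1)"
    and n: "x + y + z = n" "a + b + c + 2 \<le> n"
    and "a \<le> x" "b \<le> y" "c \<le> z"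
  shows "Suc ((x choose a) * (y choose b) * (z choose c)) \<noteq> M n (three_runs a b c)"
proof
  assume eq: "Suc ((x choose a) * (y choose b) * (z choose c)) = M n (three_runs a b c)"
  obtain x' y' z' where s': "x' + y' + z' = n" "(x' choose a) * (y' choose b) * (z' choose c) = M n (three_runs a b c)"
    using M_three_runs_attained[of b n a c] assms(2) by auto
  define f where "f u v w i = (if i = 0 then u else if i = 1 then v else w)" for u v w :: nat and i :: nat
  let ?I = "{0, 1, 2::nat}"
  have f: "f u v w 0 = u" "f u v w 1 = v" "f u v w 2 = w" for u v w by (auto simp: f_def)
  have S: "sum g ?I = g 0 + g 1 + g 2" and P: "prod g ?I = g 0 * g 1 * g 2" for g :: "nat \<Rightarrow> nat"
    by auto
  have "\<exists>i\<in>?I. \<exists>j\<in>?I. i \<noteq> j \<and> (\<forall>k\<in>?I - {i, j}. f x y z k = f a b c k)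
    \<and> f x y z i = f a b c i \<and> f x y z j = Suc (f a b c j) \<and> f a b c i = Suc (f a b c j)"
  proof (rule prod_choose_max_minus_one[where y = "f x' y' z'"])
    show "(\<Prod>k\<in>?I. g k choose f a b c k) \<le> Suc (\<Prod>k\<in>?I. f x y z k choose f a b c k)"
      if "sum g ?I = sum (f x y z) ?I" for g
      using that M_ge_three_runs[of b "g 0" "g 1" "g 2" n a c] n assms(2) unfolding S P f eq by simp
    show "\<exists>k\<in>?I. f a b c k \<noteq> 1" using assms(4) by (auto simp: f_def)
    show "(\<Prod>k\<in>?I. f x' y' z' k choose f a b c k) = Suc (\<Prod>k\<in>?I. f x y z k choose f a b c k)"
      unfolding P f using s' eq by simp
    show "sum (f x' y' z') ?I = sum (f x y z) ?I" unfolding S f using s' n by simp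
  qed (use assms in \<open>auto simp: f_def\<close>)
  then obtain i j where ij: "i \<in> ?I" "j \<in> ?I" "i \<noteq> j" "\<And>k. k \<in> ?I - {i, j} \<Longrightarrow> f x y z k = f a b c k"
      "f x y z i = f a b c i" "f x y z j = Suc (f a b c j)"
    by blast
  then have "f x y z k = f a b c k + (if k = j then 1 else 0)" if "k \<in> ?I" for k
    using that by (cases "k = i"; cases "k = j") auto
  then have "sum (f x y z) ?I = (\<Sum>k\<in>?I. f a b c k + (if k = j then 1 else 0))"
    by (rule sum.cong[OF refl])
  also have "\<dots> = sum (f a b c) ?I + 1"
    unfolding sum.distrib using ij(2) by (subst sum.delta) simp_all
  finally show False using n unfolding S f by simp
qed

text \<open>The bound on competitors is a hypothesis and not tied to \<open>M\<close>, so that the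
  lemma serves the words with \<open>c = 0\<close> as well as the splits counted by
  \<open>best_split\<close>.\<close>

lemma two_prod_max_minus_one:
  assumes "1 \<le> a" "1 \<le> c" "\<not> (a = 1 \<and> c = 1)" "a \<le> x" "c \<le> y"
    and s: "x' + y' = x + y" "(x' choose a) * (y' choose c) = Suc ((x choose a) * (y choose c))"
    and max: "\<And>u v. u + v = x + y \<Longrightarrow> (u choose a) * (v choose c) \<le> Suc ((x choose a) * (y choose c))"
  shows "(x = a \<and> y = Suc c \<and> a = Suc c) \<or> (x = Suc a \<and> y = c \<and> c = Suc a)"
proof -
  define f where "f u v i = (if i = 0 then u else v)" for u v :: nat and i :: nat
  let ?I = "{0, 1::nat}"
  have f: "f u v 0 = u" "f u v 1 = v" for u v by (auto simp: f_def)
  have S: "sum g ?I = g 0 + g 1" and P: "prod g ?I = g 0 * g 1" for g :: "nat \<Rightarrow> nat"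
    by auto
  have "\<exists>i\<in>?I. \<exists>j\<in>?I. i \<noteq> j \<and> (\<forall>k\<in>?I - {i, j}. f x y k = f a c k)
    \<and> f x y i = f a c i \<and> f x y j = Suc (f a c j) \<and> f a c i = Suc (f a c j)"
  proof (rule prod_choose_max_minus_one[where y = "f x' y'"])
    show "(\<Prod>k\<in>?I. g k choose f a c k) \<le> Suc (\<Prod>k\<in>?I. f x y k choose f a c k)"
      if "sum g ?I = sum (f x y) ?I" for g
      using that max[of "g 0" "g 1"] unfolding S P f by simp
    show "\<exists>k\<in>?I. f a c k \<noteq> 1" using assms(3) by (auto simp: f_def)
    show "(\<Prod>k\<in>?I. f x' y' k choose f a c k) = Suc (\<Prod>k\<in>?I. f x y k choose f a c k)"
      unfolding P f using s by simp
    show "sum (f x' y') ?I = sum (f x y) ?I" unfolding S f using s by simp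
  qed (use assms(1-5) in \<open>auto simp: f_def\<close>)
  then show ?thesis by (auto simp: f_def split: if_splits)
qed

lemma two_prod_neq_M_minus_one:
  assumes "1 \<le> a" "1 \<le> b" "\<not> (a = 1 \<and> b = 1)" "x + y = n" "a + b + 2 \<le> n" "a \<le> x" "b \<le> y"
  shows "Suc ((x choose a) * (y choose b)) \<noteq> M n (three_runs a b 0)"
proof
  assume eq: "Suc ((x choose a) * (y choose b)) = M n (three_runs a b 0)"
  have le: "(u choose a) * (v choose b) \<le> Suc ((x choose a) * (y choose b))" if "u + v = x + y" for u v
    using M_ge_three_runs[of b u v 0 n a 0] assms that eq by simp
  obtain x' y' z' where s': "x' + y' + z' = n" "(x' choose a) * (y' choose b) = M n (three_runs a b 0)"
    using M_three_runs_attained[of b n a 0] assms(2) by auto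
  have "(x' choose a) * (y' choose b) \<le> ((x' + z') choose a) * (y' choose b)"
    by (intro mult_le_mono1 binomial_right_mono) simp
  \<comment> \<open>With \<open>c = 0\<close> the third block adds nothing, and its letters can join
    the first block without loss.\<close>
  then have "((x' + z') choose a) * (y' choose b) = Suc ((x choose a) * (y choose b))"
    using le[of "x' + z'" y'] s' eq assms(4) by simp
  from two_prod_max_minus_one[OF assms(1,2,3,6,7) _ this le] show False
    using assms s' by auto
qed

lemma choose_two_above: "2 * ((a + 2) choose a) = (a + 2) * (a + 1)"
proof -
  have "(a + 2) choose a = (a + 2) choose 2" by (subst binomial_symmetric) auto
  then show ?thesis by (simp add: choose_two)
qed

lemma best_split_0: "best_split a 0 N = N choose a"
proof -
  obtain x where "x \<le> N" "x choose a = best_split a 0 N" using best_split_attained[of N a 0] by auto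
  then show ?thesis using best_split_ge[of N N a 0] binomial_right_mono[of x N a] by simp
qed

lemma binomial_right_strict_mono:
  assumes "x < y" "1 \<le> k" "k \<le> y"
  shows "x choose k < y choose k"
proof -
  obtain z where z: "y = Suc z" "x \<le> z" using assms(1) by (cases y) auto
  have "0 < z choose (k - 1)" using z assms by simp
  then have "z choose k < y choose k" using z assms by (simp add: choose_reduce_nat)
  with binomial_right_mono[OF z(2), of k] show ?thesis by simp
qed

text \<open>If a one stood between two zeros of a set of full weight, then for positive
  \<open>c\<close> the split at the first zero would beat \<open>best_split\<close>. For
  \<open>c = 0\<close>, full weight puts all the ones before the first zero.\<close>

lemma gap_weight_tight:
  assumes "1 \<le> a" "T \<subseteq> {..<length (gaps w)}" "i \<in> T" "j \<in> T"
    and tight: "gap_weight a c (gaps w) T = best_split a c (count_list w True)"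
    and pos: "0 < best_split a c (count_list w True)"
  shows "fst (gaps w ! i) = fst (gaps w ! j)"
proof -
  define N where "N = count_list w True"
  define r where "r k = fst (gaps w ! k)" for k
  have "finite T" using assms finite_subset by blast
  have T: "Min T \<le> k" "k \<le> Max T" "k < length (gaps w)" if "k \<in> T" for k
    using that \<open>finite T\<close> assms(2) by auto
  have "Min T \<in> T" "Max T \<in> T" using \<open>finite T\<close> assms(3) by (auto intro: Min_in Max_in)
  have rN: "r k \<le> N" "snd (gaps w ! k) = N - r k" if "k \<in> T" for k
    using gaps_nth_sum[of k w] T[OF that] by (auto simp: r_def N_def)
  have mono: "r (Min T) \<le> r k" "r k \<le> r (Max T)" if "k \<in> T" for k
    using T[OF that] T[OF \<open>Max T \<in> T\<close>] gaps_nth_mono[of "Min T" k w] gaps_nth_mono[of k "Max T" w]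
    by (auto simp: r_def)
  have gw: "(r (Min T) choose a) * ((N - r (Max T)) choose c) = best_split a c N"
    using tight rN[OF \<open>Max T \<in> T\<close>] by (simp add: gap_weight_def r_def N_def)
  have "r (Max T) \<le> r (Min T)"
  proof (cases "c = 0")
    case True
    have "N \<le> r (Min T)"
    proof (rule ccontr)
      assume "\<not> N \<le> r (Min T)"
      moreover have "0 < N choose a" using pos True by (simp add: best_split_0 N_def)
      then have "a \<le> N" by (simp add: zero_less_binomial_iff)
      ultimately have "r (Min T) choose a < N choose a"
        using \<open>1 \<le> a\<close> by (intro binomial_right_strict_mono) auto
      then show False using gw True by (simp add: best_split_0)
    qed
    then show ?thesis using rN[OF \<open>Max T \<in> T\<close>] by simp
  next
    case False
    show ?thesis
    proof (rule ccontr)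
      assume lt: "\<not> r (Max T) \<le> r (Min T)"
      have "(r (Min T) choose a) * ((N - r (Min T)) choose c) \<le> (r (Min T) choose a) * ((N - r (Max T)) choose c)"
        unfolding gw using best_split_ge rN[OF \<open>Min T \<in> T\<close>] by blast
      moreover have "0 < (r (Min T) choose a) * ((N - r (Max T)) choose c)" using gw pos by (simp add: N_def)
      moreover from this have "(N - r (Max T)) choose c < (N - r (Min T)) choose c"
        using lt False rN[OF \<open>Max T \<in> T\<close>]
        by (intro binomial_right_strict_mono) (auto simp: zero_less_binomial_iff)
      ultimately show False by simp
    qed
  qed
  then show ?thesis using mono[OF assms(3)] mono[OF assms(4)] by (auto simp: r_def)
qed

text \<open>The left side exceeds \<open>(x choose a) * k\<close> by at least \<open>a * k\<close>,
  by \<open>choose_pred_ge\<close>.\<close>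

lemma gain_one_small:
  assumes "(Suc x choose a) * k \<le> Suc ((x choose a) * k)" "1 \<le> a" "a \<le> x" "0 < k"
  shows "a = 1 \<and> k = 1"
proof -
  have "Suc x choose a = (x choose a) + (x choose (a - 1))"
    using assms(2) choose_reduce_nat[of "Suc x" a] by simp
  then have "(x choose (a - 1)) * k \<le> 1" using assms(1) by (simp add: algebra_simps)
  with mult_le_mono1[OF choose_pred_ge(1)[OF assms(2,3)], of k] have "a * k \<le> 1" by (rule le_trans)
  moreover have "a * 1 \<le> a * k" "1 * k \<le> a * k" using assms(2,4) by (auto intro: mult_le_mono)
  ultimately have "a \<le> 1" "k \<le> 1" by linarith+
  then show ?thesis using assms(2,4) by simp
qed

text \<open>A first block of \<open>a + 2\<close> ones suffices. The bound puts \<open>M - 1\<close>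
  strictly between 0 and \<open>M\<close>.\<close>

lemma three_le_M:
  assumes "1 \<le> a" "b \<noteq> 0" "a + b + c + 2 \<le> n"
  shows "3 \<le> M n (three_runs a b c)"
proof -
  have "3 * 2 \<le> (a + 2) * (a + 1)" using assms(1) by (intro mult_le_mono) auto
  then have "3 \<le> (a + 2) choose a" using choose_two_above[of a] by linarith
  moreover have "((a + 2) choose a) * (b choose b) * ((n - (a + 2) - b) choose c) \<le> M n (three_runs a b c)"
    by (rule M_ge_three_runs) (use assms in auto)
  moreover have "0 < (n - (a + 2) - b) choose c" using assms by simp
  ultimately show ?thesis
    by (metis binomial_n_n le_trans mult.right_neutral mult_le_mono2 Suc_leI One_nat_def)
qed

text \<open>For \<open>b\<close> at least 2, a deficient set \<open>T\<close> shares each of its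
  zeros with a tight \<open>b\<close>-set if further zeros exist, which makes \<open>T\<close> tight
  too. If \<open>T\<close> consists of all zeros, the outer binomials are compared with block
  words.\<close>

lemma single_zero_block_neq_M_minus_one:
  assumes "1 \<le> a" "2 \<le> b" and n: "a + b + c + 2 \<le> n" "length w = n"
    and eq: "Suc (occ (three_runs a b c) w) = M n (three_runs a b c)"
    and deficit: "M n (three_runs a b c) = (length (gaps w) choose b) * best_split a c (count_list w True)"
  shows False
proof -
  define m where "m = length (gaps w)"
  define N where "N = count_list w True"
  define V where "V = best_split a c N"
  define r where "r k = fst (gaps w ! k)" for k
  have mN: "m + N = n" using length_gaps[of w] n by (simp add: m_def N_def)
  have M3: "3 \<le> M n (three_runs a b c)" by (rule three_le_M) (use assms(1-3) in auto)
  then have "0 < (m choose b) * V" using deficit unfolding m_def N_def V_def by linarith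
  then have "V > 0" "b \<le> m" by (simp_all add: zero_less_binomial_iff)
  obtain T where T: "T \<subseteq> {..<m}" "card T = b" "Suc (gap_weight a c (gaps w) T) = V"
    and others: "\<And>U. U \<subseteq> {..<m} \<Longrightarrow> card U = b \<Longrightarrow> U \<noteq> T \<Longrightarrow> gap_weight a c (gaps w) U = V"
    using occ_deficit_one[of b a c w] eq deficit assms(2) unfolding m_def N_def V_def by auto
  have finT: "finite T" "T \<noteq> {}" using T assms(2) finite_subset by auto
  then have MT: "Min T \<in> T" "Max T \<in> T" by (auto intro: Min_in Max_in)
  have rk: "r k \<le> N" "snd (gaps w ! k) = N - r k" if "k < m" for k
    using gaps_nth_sum[of k w] that by (auto simp: r_def N_def m_def)
  have gwT: "gap_weight a c (gaps w) T = (r (Min T) choose a) * ((N - r (Max T)) choose c)"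
    using rk[of "Max T"] T(1) MT by (auto simp: gap_weight_def r_def)
  show False
  proof (cases "m = b")
    case False
    have "T \<noteq> {..<m}" using T(2) False by auto
    then obtain u where u: "u < m" "u \<notin> T" using T(1) by auto
    have same: "r z = r u \<and> (r u choose a) * ((N - r u) choose c) = V" if "z \<in> T" for z
    proof -
      have "\<exists>z'\<in>T. z' \<noteq> z"
      proof (rule ccontr)
        assume "\<not> ?thesis"
        then have "T \<subseteq> {z}" by auto
        then show False using card_mono[of "{z}" T] T(2) assms(2) by simp
      qed
      then obtain z' where z': "z' \<in> T" "z' \<noteq> z" by auto
      \<comment> \<open>Exchanging \<open>z'\<close> for the outside zero \<open>u\<close> gives a
        set other than \<open>T\<close>, hence tight, that contains both \<open>z\<close> and
        \<open>u\<close>.\<close>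
      define U where "U = insert u (T - {z'})"
      have "card U = Suc (card (T - {z'}))" using u finT by (simp add: U_def)
      also have "\<dots> = b" using z' finT T(2) assms(2) by (simp add: card_Diff_singleton)
      finally have U: "card U = b" "U \<subseteq> {..<m}" "U \<noteq> T" "u \<in> U" "z \<in> U"
        using T(1) u z' that by (auto simp: U_def)
      have gwU: "gap_weight a c (gaps w) U = V" using others U by blast
      have const: "r i = r u" if "i \<in> U" for i
        using gap_weight_tight[OF assms(1), of U w i u c] U gwU that \<open>V > 0\<close>
        by (simp add: m_def N_def V_def r_def)
      have "finite U" "U \<noteq> {}" using U finite_subset by auto
      then have "Min U \<in> U" "Max U \<in> U" by (auto intro: Min_in Max_in)
      then have "r (Min U) = r u" "snd (gaps w ! Max U) = N - r u"
        using const rk[of "Max U"] U(2) by auto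
      then have "(r u choose a) * ((N - r u) choose c) = V"
        using gwU by (simp add: gap_weight_def r_def)
      then show ?thesis using const[OF U(5)] by simp
    qed
    have "gap_weight a c (gaps w) T = V"
      unfolding gwT using same[OF MT(1)] same[OF MT(2)] by simp
    then show False using T(3) by simp
  next
    case True
    define s where "s = N - r (Max T)"
    have MV: "M n (three_runs a b c) = V" using deficit True by (simp add: m_def N_def V_def)
    then have eqV: "Suc ((r (Min T) choose a) * (s choose c)) = M n (three_runs a b c)"
      using T(3) gwT by (simp add: s_def)
    then have "0 < (r (Min T) choose a) * (s choose c)" using M3 by linarith
    then have pos: "0 < r (Min T) choose a" "0 < s choose c" by simp_all
    then have ge: "a \<le> r (Min T)" "c \<le> s" by (auto simp: zero_less_binomial_iff)
    have "r (Min T) \<le> r (Max T)"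
      using gaps_nth_mono[of "Min T" "Max T" w] finT T(1) MT by (auto simp: r_def m_def)
    then have rs: "r (Min T) + s \<le> N" using rk[of "Max T"] MT T(1) by (auto simp: s_def)
    have up: "(x choose a) * (z choose c) \<le> Suc ((r (Min T) choose a) * (s choose c))"
      if "x + z = N" for x z
      using M_ge_three_runs[of b x b z n a c] that True mN assms(2) eqV by simp
    consider "c \<noteq> 0" "r (Min T) + s = N" | "c \<noteq> 0" "r (Min T) + s < N" | "c = 0" "r (Min T) < N"
      | "c = 0" "r (Min T) = N" using rs rk[of "Min T"] MT T(1) by fastforce
    then show False
    proof cases
      case 1
      then show False
        using three_prod_neq_M_minus_one[of a b c "r (Min T)" m s n] assms True mN ge eqV by simp
    next
      case 2
      \<comment> \<open>Some ones lie between the first and the last zero, so either outer binomial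
        could take one more. Both gains are at most 1, which leaves \<open>a = c = 1\<close> and a
        product of 1, against \<open>M\<close> being at least 3.\<close>
      define s' where "s' = N - Suc (r (Min T))"
      have "s \<le> s'" using 2 by (simp add: s'_def)
      have "(Suc (r (Min T)) choose a) * (s choose c) \<le> (Suc (r (Min T)) choose a) * (s' choose c)"
        using \<open>s \<le> s'\<close> by (intro mult_le_mono2 binomial_right_mono)
      also have "\<dots> \<le> Suc ((r (Min T) choose a) * (s choose c))"
        using up[of "Suc (r (Min T))" s'] 2 by (simp add: s'_def)
      finally have 1: "a = 1 \<and> s choose c = 1"
        using gain_one_small[of "r (Min T)" a "s choose c"] assms(1) ge pos by blast
      define x' where "x' = N - Suc s"
      have "(Suc s choose c) * (r (Min T) choose a) \<le> (Suc s choose c) * (x' choose a)"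
        using 2 by (intro mult_le_mono2 binomial_right_mono) (simp add: x'_def)
      also have "\<dots> \<le> Suc ((s choose c) * (r (Min T) choose a))"
        using up[of x' "Suc s"] 2 by (simp add: x'_def mult.commute)
      finally have "c = 1 \<and> r (Min T) choose a = 1"
        using gain_one_small[of s c "r (Min T) choose a"] 2 ge pos by (simp add: Suc_le_eq)
      then show False using 1 eqV M3 by simp
    next
      case 3
      have "(Suc (r (Min T)) choose a) \<le> (N choose a)"
        using 3 by (intro binomial_right_mono) simp
      also have "\<dots> \<le> Suc (r (Min T) choose a)" using up[of N 0] 3 by simp
      finally have "a = 1" using gain_one_small[of "r (Min T)" a 1] assms(1) ge by simp
      \<comment> \<open>Replacing one of the ones by a zero yields more than the supposed maximum
        \<open>N\<close>.\<close>
      have "(N - 1) * Suc b \<le> M n (three_runs a b c)"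
        using M_ge_three_runs[of b "N - 1" "Suc b" 0 n a c] True mN 3 \<open>a = 1\<close> assms(2)
        by (simp add: Suc_diff_Suc)
      moreover have "(N - 1) * 3 \<le> (N - 1) * Suc b" using assms(2) by (intro mult_le_mono2) simp
      moreover have "N \<ge> 3" using mN True n \<open>a = 1\<close> by simp
      moreover have "M n (three_runs a b c) = N"
        using MV \<open>a = 1\<close> 3 by (simp add: V_def best_split_0)
      ultimately show False by simp
    next
      case 4
      then show False using eqV MV by (simp add: V_def best_split_0)
    qed
  qed
qed

text \<open>For \<open>b = 1\<close> the deficient set is one zero, whose split of the ones has
  value \<open>V - 1\<close>. By \<open>two_prod_max_minus_one\<close> this happens only when
  \<open>N = a + c + 1\<close> and \<open>a\<close>, \<open>c\<close> differ by 1; replacing a zero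
  by a one then beats \<open>m * V\<close> except in the stated cases.\<close>

lemma single_zero_neq_M_minus_one:
  assumes "1 \<le> a" "\<not> (a = 1 \<and> c \<le> 1)" and n: "a + c + 3 \<le> n" "length w = n"
    and eq: "Suc (occ (three_runs a 1 c) w) = M n (three_runs a 1 c)"
    and deficit: "M n (three_runs a 1 c) = length (gaps w) * best_split a c (count_list w True)"
  shows "n = a + c + 3 \<and> (a = 2 \<and> c = 1 \<or> a = 1 \<and> c = 2)"
proof -
  define m where "m = length (gaps w)"
  define N where "N = count_list w True"
  define V where "V = best_split a c N"
  have mN: "m + N = n" using length_gaps[of w] n by (simp add: m_def N_def)
  have M3: "3 \<le> M n (three_runs a 1 c)" by (rule three_le_M) (use assms(1-3) in auto)
  have MV: "M n (three_runs a 1 c) = m * V" using deficit by (simp add: m_def N_def V_def)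
  obtain T where T: "T \<subseteq> {..<m}" "card T = 1" "Suc (gap_weight a c (gaps w) T) = V"
  proof -
    have "Suc (occ (three_runs a 1 c) w) = (length (gaps w) choose 1) * best_split a c (count_list w True)"
      using eq deficit by simp
    from occ_deficit_one[OF one_neq_zero this] that show ?thesis
      unfolding m_def N_def V_def by metis
  qed
  obtain i where i: "T = {i}" using T(2) by (rule card_1_singletonE)
  then have im: "i < m" using T(1) by simp
  define r where "r = fst (gaps w ! i)"
  have "r + snd (gaps w ! i) = N"
    using gaps_nth_sum[of i w] im by (simp add: r_def N_def m_def)
  then have r: "r \<le> N" "Suc ((r choose a) * ((N - r) choose c)) = V"
    using T(3) unfolding i by (auto simp: gap_weight_def r_def)
  have up: "(x choose a) * ((N - x) choose c) \<le> V" if "x \<le> N" for x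
    using best_split_ge[OF that] by (simp add: V_def)
  obtain x where x: "x \<le> N" "(x choose a) * ((N - x) choose c) = V"
    using best_split_attained[of N a c] by (auto simp: V_def)
  have "V > 0" using r(2) by auto
  then have "0 < (x choose a) * ((N - x) choose c)" using x(2) by linarith
  then have xge: "a \<le> x" "c \<le> N - x" by (simp_all add: zero_less_binomial_iff)
  have lower: "(u choose a) * y * (z choose c) \<le> m * V" if "u + y + z = n" for u y z
    using M_ge_three_runs[of 1 u y z n a c] that MV by simp
  \<comment> \<open>Then \<open>N = a + c\<close>, so there are at least three zeros, and replacing
    one of them by a one gives \<open>Suc a * (m - 1)\<close>, more than \<open>m\<close>.\<close>
  have no_tight: False if "V = 1"
  proof -
    have "N = a + c"
    proof (rule ccontr)
      assume "N \<noteq> a + c"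
      then have N: "a + c < N" using xge x(1) by simp
      have "(Suc a choose a) * 1 \<le> (Suc a choose a) * ((N - Suc a) choose c)"
        using N by (intro mult_le_mono2) (simp add: Suc_le_eq)
      also have "\<dots> \<le> V" using N by (intro up) simp
      finally show False using that assms(1) by simp
    qed
    then have "Suc a * (m - 1) \<le> m"
      using lower[of "Suc a" "m - 1" c] mN n that by (simp add: mult.assoc)
    moreover have "2 * (m - 1) \<le> Suc a * (m - 1)" using assms(1) by (intro mult_le_mono1) simp
    moreover have "m \<ge> 3" using mN n \<open>N = a + c\<close> by simp
    ultimately show False by simp
  qed
  show ?thesis
  proof (cases "(r choose a) * ((N - r) choose c) = 0")
    case True
    then have "V = 1" using r(2) unfolding True by simp
    then show ?thesis using no_tight by blast
  next
    case False
    then have ge: "a \<le> r" "c \<le> N - r" by (auto simp: binomial_eq_0_iff)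
    show ?thesis
    proof (cases "c = 0")
      case True
      have "r \<noteq> N" using r(2) True by (auto simp: V_def best_split_0)
      have "(Suc r choose a) * 1 \<le> V" using up[of "Suc r"] True \<open>r \<noteq> N\<close> r(1) by simp
      then have "a = 1" using gain_one_small[of r a 1] r(2) True assms(1) ge by simp
      then show ?thesis using True assms(2) by simp
    next
      case False
      have cases: "(r = a \<and> N - r = Suc c \<and> a = Suc c) \<or> (r = Suc a \<and> N - r = c \<and> c = Suc a)"
      proof (rule two_prod_max_minus_one)
        show "x + (N - x) = r + (N - r)" using x r by simp
        show "(x choose a) * ((N - x) choose c) = Suc ((r choose a) * ((N - r) choose c))" using x r by simp
        show "(u choose a) * (v choose c) \<le> Suc ((r choose a) * ((N - r) choose c))"
          if "u + v = r + (N - r)" for u v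
        proof -
          have "u \<le> N" "v = N - u" using that r(1) by auto
          then show ?thesis using up[of u] r by simp
        qed
      qed (use assms ge False in auto)
      \<comment> \<open>Here \<open>d\<close> is the smaller of \<open>a\<close> and
        \<open>c\<close>, so that both symmetric cases are covered. The comparison reduces to
        \<open>(m - 1) * (d + 3) <= 2 * m\<close>, which forces \<open>m = 2\<close> and
        \<open>d = 1\<close>.\<close>
      have *: "n = d + 1 + d + 3 \<and> d = 1"
        if "N = 2 * d + 2" "V = d + 2" "2 * ((m - 1) * ((d + 3) choose (d + 1))) \<le> 2 * (m * V)" "d \<ge> 1"
          "n \<ge> 2 * d + 4" for d
      proof -
        have C: "2 * ((d + 3) choose (d + 1)) = (d + 3) * (d + 2)"
          using choose_two_above[of "d + 1"] by (simp add: eval_nat_numeral)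
        have "((m - 1) * (d + 3)) * (d + 2) = (m - 1) * (2 * ((d + 3) choose (d + 1)))"
          unfolding C by (simp only: mult.assoc)
        also have "\<dots> = 2 * ((m - 1) * ((d + 3) choose (d + 1)))" by (rule mult.left_commute)
        also have "\<dots> \<le> 2 * (m * V)" by (rule that(3))
        also have "\<dots> = (2 * m) * (d + 2)" unfolding that(2) by (rule mult.assoc[symmetric])
        finally have le: "(m - 1) * (d + 3) \<le> 2 * m" by (simp only: mult_le_cancel2)
        moreover have "(m - 1) * 4 \<le> (m - 1) * (d + 3)" using that by (intro mult_le_mono2) simp
        ultimately have "m \<le> 2" by linarith
        moreover have "m \<ge> 2" using mN that by simp
        ultimately have "m = 2" by simp
        then show ?thesis using le mN that by simp
      qed
      from cases show ?thesis
      proof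
        assume c: "r = a \<and> N - r = Suc c \<and> a = Suc c"
        have "n = c + 1 + c + 3 \<and> c = 1"
        proof (rule *)
          have "1 \<le> m" using mN c r(1) n by linarith
          then have "((a + 2) choose a) * (m - 1) * (c choose c) \<le> m * V"
            using mN c r(1) by (intro lower) linarith
          then show "2 * ((m - 1) * ((c + 3) choose (c + 1))) \<le> 2 * (m * V)"
            using c by (simp add: mult.commute eval_nat_numeral)
        qed (use c r False n in auto)
        then show ?thesis using c by simp
      next
        assume c: "r = Suc a \<and> N - r = c \<and> c = Suc a"
        have "n = a + 1 + a + 3 \<and> a = 1"
        proof (rule *)
          have "1 \<le> m" using mN c r(1) n by linarith
          then have "(a choose a) * (m - 1) * ((c + 2) choose c) \<le> m * V"
            using mN c r(1) by (intro lower) linarith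
          then show "2 * ((m - 1) * ((a + 3) choose (a + 1))) \<le> 2 * (m * V)"
            using c by (simp add: eval_nat_numeral)
        qed (use c r assms(1) n in auto)
        then show ?thesis using c by simp
      qed
    qed
  qed
qed

text \<open>The bound of \<open>occ_le_best_split\<close> lies between \<open>M - 1\<close> and
  \<open>M\<close>. If it is \<open>M - 1\<close>, a product of binomials takes that value, which is
  excluded; if it is \<open>M\<close>, the word has deficit 1.\<close>

lemma occ_eq_M_minus_one_imp:
  assumes "1 \<le> a" "1 \<le> b" "\<not> (a = 1 \<and> b = 1 \<and> c \<le> 1)" and n: "a + b + c + 2 \<le> n" "length w = n"
    and eq: "Suc (occ (three_runs a b c) w) = M n (three_runs a b c)"
  shows "b = 1 \<and> n = a + c + 3 \<and> (a = 2 \<and> c = 1 \<or> a = 1 \<and> c = 2)"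
proof -
  let ?m = "length (gaps w)" and ?N = "count_list w True"
  have mN: "?m + ?N = n" using length_gaps n(2) by simp
  have le: "(?m choose b) * best_split a c ?N \<le> M n (three_runs a b c)"
    using best_split_le_M mN assms(2) by simp
  have ge: "occ (three_runs a b c) w \<le> (?m choose b) * best_split a c ?N"
    using occ_le_best_split assms(2) by simp
  have M3: "3 \<le> M n (three_runs a b c)" by (rule three_le_M) (use assms(1-4) in auto)
  have deficit: "M n (three_runs a b c) = (?m choose b) * best_split a c ?N"
  proof (rule ccontr)
    assume "\<not> ?thesis"
    then have eq': "Suc ((?m choose b) * best_split a c ?N) = M n (three_runs a b c)" using le ge eq by simp
    obtain x where x: "x \<le> ?N" "(x choose a) * ((?N - x) choose c) = best_split a c ?N"
      using best_split_attained by blast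
    show False
    proof (cases "c = 0")
      case True
      have "Suc ((?N choose a) * (?m choose b)) = M n (three_runs a b 0)"
        using eq' True by (simp add: best_split_0 mult.commute)
      moreover from this have "0 < (?N choose a) * (?m choose b)" using M3[unfolded True] by linarith
      then have "a \<le> ?N" "b \<le> ?m" by (simp_all add: zero_less_binomial_iff)
      ultimately show False
        using two_prod_neq_M_minus_one[of a b ?N ?m n] assms True mN by simp
    next
      case False
      have "Suc ((x choose a) * (?m choose b) * ((?N - x) choose c)) = M n (three_runs a b c)"
        using eq' x(2) by (metis mult.assoc mult.commute)
      moreover from this have "0 < (x choose a) * (?m choose b) * ((?N - x) choose c)" using M3 by linarith
      then have "a \<le> x" "b \<le> ?m" "c \<le> ?N - x" by (simp_all add: zero_less_binomial_iff)
      ultimately show False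
        using three_prod_neq_M_minus_one[of a b c x ?m "?N - x" n] assms(1-4) False mN x(1)
        by force
    qed
  qed
  show ?thesis
  proof (cases "b = 1")
    case True
    then show ?thesis
      using single_zero_neq_M_minus_one[of a c n w] assms deficit by simp
  next
    case False
    then show ?thesis
      using single_zero_block_neq_M_minus_one[of a b c n w] assms deficit by auto
  qed
qed

section \<open>Alternating words\<close>

lemma not_internal_zeroI:
  assumes "\<And>w k. length w = n \<Longrightarrow> k < occ p w \<Longrightarrow> \<exists>w'. length w' = n \<and> occ p w' = k"
  shows "\<not> internal_zero p n"
  using assms unfolding internal_zero_def B_neq_0_iff by (metis B_neq_0_iff)

text \<open>A zero is inserted behind \<open>r\<close> ones. Quantifying over all \<open>g\<close>
  says that the gaps gain this pair as a multiset, without tracking where it lands.\<close>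

lemma insert_gap:
  assumes "r \<le> count_list w True"
  shows "\<exists>w'. length w' = Suc (length w) \<and> count_list w' True = count_list w True \<and>
    (\<forall>g :: nat \<times> nat \<Rightarrow> nat. sum_list (map g (gaps w')) = g (r, count_list w True - r) + sum_list (map g (gaps w)))"
  using assms
proof (induction w arbitrary: r rule: gaps.induct)
  case 1
  then show ?case by (intro exI[of _ "[False]"]) auto
next
  case (2 w)
  show ?case
  proof (cases r)
    case 0
    then show ?thesis by (intro exI[of _ "False # True # w"]) auto
  next
    case (Suc r')
    then obtain w' where w': "length w' = Suc (length w)" "count_list w' True = count_list w True"
      "\<And>g :: nat \<times> nat \<Rightarrow> nat. sum_list (map g (gaps w')) = g (r', count_list w True - r') + sum_list (map g (gaps w))"
      using 2 by auto
    show ?thesis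
      using w'(1,2) w'(3)[of "g \<circ> apfst Suc" for g] Suc
      by (intro exI[of _ "True # w'"]) (auto simp: o_def)
  qed
next
  case (3 w)
  then obtain w' where w': "length w' = Suc (length w)" "count_list w' True = count_list w True"
    "\<And>g :: nat \<times> nat \<Rightarrow> nat. sum_list (map g (gaps w')) = g (r, count_list w True - r) + sum_list (map g (gaps w))"
    by auto
  then show ?case by (intro exI[of _ "False # w'"]) auto
qed

text \<open>Zeros can be placed independently of each other, which turns the attained values for 10
  and 101 into a question about sums of freely chosen terms.\<close>

lemma realize_gaps:
  assumes "\<forall>r\<in>set rs. r \<le> N"
  shows "\<exists>w. length w = N + length rs \<and> count_list w True = N \<and>
    (\<forall>g :: nat \<times> nat \<Rightarrow> nat. sum_list (map g (gaps w)) = (\<Sum>r\<leftarrow>rs. g (r, N - r)))"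
  using assms
proof (induction rs)
  case Nil
  have "gaps (replicate N True) = []" by (induction N) auto
  then show ?case by (intro exI[of _ "replicate N True"]) (simp add: count_list_replicate_same)
next
  case (Cons r rs)
  then obtain w where w: "length w = N + length rs" "count_list w True = N"
    "\<And>g :: nat \<times> nat \<Rightarrow> nat. sum_list (map g (gaps w)) = (\<Sum>r\<leftarrow>rs. g (r, N - r))"
    by auto
  from insert_gap[of r w] Cons.prems w show ?case by auto
qed

lemma occ_10: "occ [True, False] w = (\<Sum>(r, s)\<leftarrow>gaps w. r)"
  using occ_three_runs[of 1 1 0 w] gap_sum_1[of 1 0 "gaps w"] by (simp add: three_runs_def)

lemma occ_101: "occ [True, False, True] w = (\<Sum>(r, s)\<leftarrow>gaps w. r * s)"
  using occ_three_runs[of 1 1 1 w] gap_sum_1[of 1 1 "gaps w"] by (simp add: three_runs_def)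

lemma bounded_list_with_sum: "k \<le> m * N \<Longrightarrow> \<exists>rs. length rs = m \<and> (\<forall>r\<in>set rs. r \<le> N) \<and> sum_list rs = k"
proof (induction m arbitrary: k)
  case (Suc m)
  then obtain rs where "length rs = m" "\<forall>r\<in>set rs. r \<le> N" "sum_list rs = k - N"
    by (metis le_diff_conv mult_Suc add.commute)
  then show ?case by (intro exI[of _ "min k N # rs"]) auto
qed simp

text \<open>The numbers of zeros and ones of \<open>w\<close> are kept and only the zeros move;
  their left counts range freely up to the number of ones.\<close>

lemma not_internal_zero_10: "\<not> internal_zero [True, False] n"
proof (rule not_internal_zeroI)
  fix w k assume w: "length w = n" "k < occ [True, False] w"
  let ?m = "length (gaps w)" and ?N = "count_list w True"
  have "(\<Sum>(r, s)\<leftarrow>gaps w. r) \<le> ?m * ?N"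
  proof -
    have "fst z \<le> ?N" if "z \<in> set (gaps w)" for z
      using that gaps_nth_sum[of _ w] by (metis in_set_conv_nth le_add1)
    then have "(\<Sum>(r, s)\<leftarrow>gaps w. r) \<le> (\<Sum>z\<leftarrow>gaps w. ?N)"
      by (intro sum_list_mono) auto
    then show ?thesis by (simp add: sum_list_triv)
  qed
  then have "k \<le> ?m * ?N" using w by (simp add: occ_10)
  then obtain rs where rs: "length rs = ?m" "\<forall>r\<in>set rs. r \<le> ?N" "sum_list rs = k"
    using bounded_list_with_sum by blast
  obtain w' where "length w' = ?N + length rs" "(\<Sum>(r, s)\<leftarrow>gaps w'. r) = (\<Sum>r\<leftarrow>rs. r)"
    using realize_gaps[OF rs(2)] by fastforce
  then show "\<exists>w'. length w' = n \<and> occ [True, False] w' = k"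
    using rs w(1) length_gaps[of w] by (auto simp: occ_10 add.commute)
qed

section \<open>The values attained for the word 101\<close>

definition attains :: "nat \<Rightarrow> nat \<Rightarrow> bool" where
  "attains n k \<longleftrightarrow> (\<exists>w. length w = n \<and> occ [True, False, True] w = k)"

text \<open>A leading zero takes part in no occurrence of a word that begins with a one.\<close>

lemma attains_Suc: "attains n k \<Longrightarrow> attains (Suc n) k"
  unfolding attains_def by (metis length_Cons occ_Cons_Cons add_0_right)

lemma attains_mono: "n \<le> n' \<Longrightarrow> attains n k \<Longrightarrow> attains n' k"
  by (induction n' rule: dec_induct) (auto intro: attains_Suc)

lemma attains_sum_list:
  assumes "\<forall>r\<in>set rs. r \<le> N"
  shows "attains (N + length rs) (\<Sum>r\<leftarrow>rs. r * (N - r))"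
  using realize_gaps[OF assms] unfolding attains_def occ_101 by fastforce

text \<open>A table entry is a certificate: the number of ones and the left counts of the zeros. The
  entries realize the values from \<open>lo\<close> to \<open>hi - 1\<close> in order.\<close>

lemma attains_table:
  assumes "map (\<lambda>(N, rs). \<Sum>r\<leftarrow>rs. r * (N - r)) T = [lo..<hi]" "lo \<le> k" "k < hi"
    and "\<forall>(N, rs)\<in>set T. N + length rs = n \<and> (\<forall>r\<in>set rs. r \<le> N)"
  shows "attains n k"
proof -
  have "k \<in> set [lo..<hi]" using assms by simp
  then obtain N rs where "(N, rs) \<in> set T" "k = (\<Sum>r\<leftarrow>rs. r * (N - r))"
    unfolding assms(1)[symmetric] by auto
  then show ?thesis using assms(4) attains_sum_list[of rs N] by auto
qed

lemma floor_sqrt_bounded: "d < (Suc t)^2 \<Longrightarrow> \<exists>j\<le>t. j^2 \<le> d \<and> d < (Suc j)^2" for d :: nat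
proof (induction t)
  case (Suc t)
  show ?case
  proof (cases "d < (Suc t)^2")
    case True
    with Suc.IH show ?thesis using le_SucI by blast
  next
    case False
    with Suc.prems show ?thesis by (intro exI[of _ "Suc t"]) auto
  qed
qed simp

text \<open>Greedy choice of the largest square leaves a remainder of at most \<open>2 t < t\<^sup>2\<close>.\<close>

lemma sum_of_few_squares:
  assumes "4 \<le> t" "d < (Suc t)^2"
  shows "\<exists>js. length js = t \<and> (\<forall>j\<in>set js. j \<le> t) \<and> (\<Sum>j\<leftarrow>js. j^2) = d"
  using assms
proof (induction t arbitrary: d rule: dec_induct)
  case base
  \<comment> \<open>The entry at position \<open>d\<close> writes \<open>d\<close> as a sum of four
    squares of numbers up to 4.\<close>
  define T :: "nat list list" where "T =
      [[0, 0, 0, 0], [1, 0, 0, 0], [1, 1, 0, 0], [1, 1, 1, 0], [2, 0, 0, 0], [2, 1, 0, 0], [2, 1,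
      1, 0], [2, 1, 1, 1], [2, 2, 0, 0], [3, 0, 0, 0], [3, 1, 0, 0], [3, 1, 1, 0], [3, 1, 1, 1],
      [3, 2, 0, 0], [3, 2, 1, 0], [3, 2, 1, 1], [4, 0, 0, 0], [4, 1, 0, 0], [4, 1, 1, 0], [4, 1,
      1, 1], [4, 2, 0, 0], [4, 2, 1, 0], [4, 2, 1, 1], [3, 3, 2, 1], [4, 2, 2, 0]]"
  have "map (\<lambda>js. \<Sum>j\<leftarrow>js. j^2) T = [0..<25]"
    by (simp add: T_def upt_rec)
  moreover have "\<forall>js\<in>set T. length js = 4 \<and> (\<forall>j\<in>set js. j \<le> 4)" by (simp add: T_def)
  moreover have "d \<in> set [0..<25]" using base by simp
  ultimately show ?case by (metis (no_types, lifting) imageE list.set_map)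
next
  case (step t)
  obtain j where j: "j \<le> Suc t" "j^2 \<le> d" "d < (Suc j)^2"
    using floor_sqrt_bounded step.prems by blast
  have "d - j^2 \<le> 2 * Suc t" using j by (simp add: power2_eq_square)
  also have "\<dots> < (Suc t)^2"
    unfolding power2_eq_square using step.hyps by (intro mult_less_mono1) auto
  finally obtain js where "length js = t" "\<forall>j\<in>set js. j \<le> t" "(\<Sum>j\<leftarrow>js. j^2) = d - j^2"
    using step.IH by blast
  then show ?case using j by (intro exI[of _ "j # js"]) auto
qed

text \<open>With \<open>2 h\<close> ones, a zero displaced by \<open>j\<close> from the middle lies in \<open>(h - j) (h + j)\<close>
  occurrences of 101.\<close>

lemma attains_deficit:
  assumes "4 \<le> t" "t \<le> m" "t \<le> h" "d < (Suc t)^2"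
  shows "attains (m + 2 * h) (m * h^2 - d)"
proof -
  obtain js where js: "length js = t" "\<forall>j\<in>set js. j \<le> t" "(\<Sum>j\<leftarrow>js. j^2) = d"
    using sum_of_few_squares assms by blast
  have split: "(\<Sum>j\<leftarrow>ks. (h - j) * (2 * h - (h - j))) + (\<Sum>j\<leftarrow>ks. j^2) = length ks * h^2"
    if "\<forall>j\<in>set ks. j \<le> h" for ks
    using that
  proof (induction ks)
    case (Cons j ks)
    then obtain i where "h = i + j" by (metis le_add_diff_inverse2 list.set_intros(1))
    then have "(h - j) * (2 * h - (h - j)) + j^2 = h^2"
      by (simp add: power2_eq_square algebra_simps)
    then show ?case using Cons by simp
  qed simp
  \<comment> \<open>The other \<open>m - t\<close> zeros stand in the middle, with no
    displacement.\<close>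
  define ks where "ks = js @ replicate (m - t) 0"
  have ks: "length ks = m" "\<forall>j\<in>set ks. j \<le> h" "(\<Sum>j\<leftarrow>ks. j^2) = d"
    using js assms by (auto simp: ks_def sum_list_replicate)
  have "attains (2 * h + length (map (\<lambda>j. h - j) ks)) (\<Sum>r\<leftarrow>map (\<lambda>j. h - j) ks. r * (2 * h - r))"
    by (rule attains_sum_list) auto
  moreover have "(\<Sum>r\<leftarrow>map (\<lambda>j. h - j) ks. r * (2 * h - r)) = m * h^2 - d"
    using split[OF ks(2)] ks by (simp add: o_def)
  ultimately show ?thesis using ks(1) by (simp add: add.commute)
qed

text \<open>The three factors are the parts of the most balanced splitting of \<open>n\<close> into
  three.\<close>

definition max_101 :: "nat \<Rightarrow> nat" where
  "max_101 n = (n div 3) * ((n + 1) div 3) * ((n + 2) div 3)"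

lemma max_101_simps:
  "max_101 (3 * t) = t * t * t"
  "max_101 (3 * t + 1) = t * t * (t + 1)"
  "max_101 (3 * t + 2) = t * (t + 1) * (t + 1)"
proof -
  have "(3 * t + 1) div 3 = t" "(3 * t + 2) div 3 = t" "(3 * t + 3) div 3 = t + 1" "(3 * t + 4) div 3 = t + 1"
    by presburger+
  then show "max_101 (3 * t) = t * t * t"
    "max_101 (3 * t + 1) = t * t * (t + 1)"
    "max_101 (3 * t + 2) = t * (t + 1) * (t + 1)"
    by (simp_all add: max_101_def)
qed

lemma mod_3_cases:
  fixes n :: nat
  obtains t where "n = 3 * t" | t where "n = 3 * t + 1" | t where "n = 3 * t + 2"
proof -
  have "n = 3 * (n div 3) \<or> n = 3 * (n div 3) + 1 \<or> n = 3 * (n div 3) + 2" by presburger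
  then show ?thesis using that by blast
qed

text \<open>The induction lowers all three factors at once. The product then drops by
  \<open>e + n + 1\<close>, where \<open>e\<close> is the second elementary symmetric function of
  the lowered factors, and \<open>3 * e <= n * n\<close> because the squared differences are
  nonnegative.\<close>

lemma prod_le_max_101: "x * y * z \<le> max_101 (x + y + z)"
proof (induction x arbitrary: y z)
  case (Suc x)
  show ?case
  proof (cases "y = 0 \<or> z = 0")
    case False
    then obtain v w where vw: "y = Suc v" "z = Suc w" using not0_implies_Suc by blast
    define e where "e = x * v + v * w + x * w"
    define n where "n = x + v + w"
    have e: "3 * e \<le> n * n"
    proof -
      have "0 \<le> (int x - int v)^2 + (int v - int w)^2 + (int x - int w)^2" by simp
      then have "3 * int e \<le> int n * int n"
        by (simp add: e_def n_def power2_eq_square algebra_simps)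
      then show ?thesis by (metis of_nat_le_iff of_nat_mult of_nat_numeral)
    qed
    \<comment> \<open>If \<open>n\<close> is not a multiple of 3, its square leaves remainder 1,
      which integrality of \<open>e\<close> absorbs.\<close>
    have third: "e \<le> u" if "3 * e \<le> 3 * u + 1" for u
      using that by presburger
    have "e + n + 1 + max_101 n \<le> max_101 (n + 3)"
    proof (cases rule: mod_3_cases[of n])
      case (1 t)
      then have "e \<le> 3 * t * t" using e by simp
      then show ?thesis using max_101_simps(1)[of t] max_101_simps(1)[of "t + 1"] 1
        by (simp add: algebra_simps)
    next
      case (2 t)
      then have "3 * e \<le> 3 * (3 * t * t + 2 * t) + 1" using e by (simp add: algebra_simps)
      then have "e \<le> 3 * t * t + 2 * t" by (rule third)
      then show ?thesis using max_101_simps(2)[of t] max_101_simps(2)[of "t + 1"] 2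
        by (simp add: algebra_simps)
    next
      case (3 t)
      then have "3 * e \<le> 3 * (3 * t * t + 4 * t + 1) + 1" using e by (simp add: algebra_simps)
      then have "e \<le> 3 * t * t + 4 * t + 1" by (rule third)
      then show ?thesis using max_101_simps(3)[of t] max_101_simps(3)[of "t + 1"] 3
        by (simp add: algebra_simps)
    qed
    moreover have prod: "Suc x * y * z = x * v * w + e + n + 1"
      unfolding vw e_def n_def by (simp add: algebra_simps)
    moreover have "x * v * w \<le> max_101 n" using Suc.IH by (simp add: n_def)
    moreover have sum: "Suc x + y + z = n + 3" by (simp add: vw n_def)
    ultimately show ?thesis unfolding prod sum by linarith
  qed auto
qed simp

lemma occ_101_le: "occ [True, False, True] w \<le> max_101 (length w)"
proof -
  let ?m = "length (gaps w)" and ?N = "count_list w True"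
  obtain x where x: "x \<le> ?N" "(x choose 1) * ((?N - x) choose 1) = best_split 1 1 ?N"
    using best_split_attained by blast
  have "occ [True, False, True] w \<le> ?m * (x * (?N - x))"
    using occ_le_best_split[of 1 1 1 w] x by (simp add: three_runs_def)
  also have "\<dots> = ?m * x * (?N - x)" by simp
  also have "\<dots> \<le> max_101 (?m + x + (?N - x))" by (rule prod_le_max_101)
  also have "?m + x + (?N - x) = length w" using length_gaps[of w] x(1) by simp
  finally show ?thesis .
qed

text \<open>From length 8 on, a table lists only the values above the maximum for the previous
  length; smaller ones are inherited by \<open>attains_mono\<close>.\<close>

lemma attains_small: "7 \<le> n \<Longrightarrow> n \<le> 11 \<Longrightarrow> k \<le> max_101 n \<Longrightarrow> attains n k"
proof -
  have t7: "attains 7 k" if "0 \<le> k" "k < 13" for k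
    by (rule attains_table[of
      "[(0, [0, 0, 0, 0, 0, 0, 0]), (2, [0, 0, 0, 0, 1]), (2, [0, 0, 0, 1, 1]), (2, [0, 0, 1, 1,
      1]), (2, [0, 1, 1, 1, 1]), (2, [1, 1, 1, 1, 1]), (3, [0, 1, 1, 1]), (4, [0, 1, 2]), (3, [1,
      1, 1, 1]), (4, [1, 1, 1]), (4, [1, 1, 2]), (4, [1, 2, 2]), (4, [2, 2, 2])]" 0 13])
      (use that in \<open>simp_all add: upt_rec\<close>)
  have t8: "attains 8 k" if "13 \<le> k" "k < 19" for k
    by (rule attains_table[of
      "[(4, [1, 1, 1, 2]), (4, [1, 1, 2, 2]), (4, [1, 2, 2, 2]), (4, [2, 2, 2, 2]), (6, [2, 3]),
      (5, [2, 2, 2])]" 13 19])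
      (use that in \<open>simp_all add: upt_rec\<close>)
  have t9: "attains 9 k" if "19 \<le> k" "k < 28" for k
    by (rule attains_table[of
      "[(4, [1, 2, 2, 2, 2]), (4, [2, 2, 2, 2, 2]), (6, [1, 2, 2]), (5, [1, 2, 2, 2]), (6, [1, 3,
      3]), (5, [2, 2, 2, 2]), (6, [2, 2, 3]), (6, [2, 3, 3]), (6, [3, 3, 3])]" 19 28])
      (use that in \<open>simp_all add: upt_rec\<close>)
  have t10: "attains 10 k" if "28 \<le> k" "k < 37" for k
    by (rule attains_table[of
      "[(5, [1, 2, 2, 2, 2]), (6, [1, 2, 2, 2]), (5, [2, 2, 2, 2, 2]), (6, [1, 2, 3, 3]), (6, [1,
      3, 3, 3]), (6, [2, 2, 2, 3]), (6, [2, 2, 3, 3]), (6, [2, 3, 3, 3]), (6, [3, 3, 3, 3])]" 28 37])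
      (use that in \<open>simp_all add: upt_rec\<close>)
  have t11: "attains 11 k" if "37 \<le> k" "k < 49" for k
    by (rule attains_table[of
      "[(6, [1, 1, 3, 3, 3]), (6, [1, 2, 2, 2, 3]), (6, [1, 2, 2, 3, 3]), (6, [1, 2, 3, 3, 3]), (6,
      [1, 3, 3, 3, 3]), (6, [2, 2, 2, 3, 3]), (6, [2, 2, 3, 3, 3]), (6, [2, 3, 3, 3, 3]), (6, [3,
      3, 3, 3, 3]), (7, [2, 3, 3, 3]), (8, [3, 4, 4]), (7, [3, 3, 3, 3])]" 37 49])
      (use that in \<open>simp_all add: upt_rec\<close>)
  assume n: "7 \<le> n" "n \<le> 11" "k \<le> max_101 n"
  then consider "n = 7" | "n = 8" | "n = 9" | "n = 10" | "n = 11" by linarith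
  then have "k < 13 \<or> 8 \<le> n \<and> k < 19 \<or> 9 \<le> n \<and> k < 28 \<or> 10 \<le> n \<and> k < 37 \<or> 11 \<le> n \<and> k < 49"
    by cases (use n(3) in \<open>auto simp: max_101_def\<close>)
  then consider "k < 13" | "8 \<le> n" "13 \<le> k" "k < 19" | "9 \<le> n" "19 \<le> k" "k < 28"
    | "10 \<le> n" "28 \<le> k" "k < 37" | "11 \<le> n" "37 \<le> k" "k < 49"
    by linarith
  then show ?thesis
    by cases (use n(1) attains_mono t7 t8 t9 t10 t11 in \<open>metis le0\<close>)+
qed

text \<open>Values up to \<open>max_101 n\<close> are inherited. The new ones are close enough to
  the maximum for \<open>attains_deficit\<close>, with \<open>m\<close> and \<open>h\<close> taken
  from the balanced splitting \<open>m + 2 * h = Suc n\<close>.\<close>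

lemma attains_le_max_101: "7 \<le> n \<Longrightarrow> k \<le> max_101 n \<Longrightarrow> attains n k"
proof (induction n rule: dec_induct)
  case base
  then show ?case using attains_small by simp
next
  case (step n)
  show ?case
  proof (cases "k \<le> max_101 n \<or> Suc n \<le> 11")
    case True
    then show ?thesis using step attains_Suc attains_small[of "Suc n" k] by auto
  next
    case False
    then have k: "max_101 n < k" "k \<le> max_101 (Suc n)" "11 \<le> n" using step.prems by auto
    show ?thesis
    proof (cases rule: mod_3_cases[of n])
      case (1 t)
      define d where "d = (t + 1) * t^2 - k"
      have "d < (Suc t)^2" "k = (t + 1) * t^2 - d"
        using k max_101_simps(1,2)[of t] 1 by (auto simp: d_def power2_eq_square algebra_simps)
      then show ?thesis
        using attains_deficit[of t "t + 1" t d] k(3) 1 by (simp add: algebra_simps)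
    next
      case (2 t)
      define d where "d = t * (t + 1)^2 - k"
      have "d < (Suc t)^2" "k = t * (t + 1)^2 - d"
        using k max_101_simps(2,3)[of t] 2 by (auto simp: d_def power2_eq_square algebra_simps)
      then show ?thesis
        using attains_deficit[of t t "t + 1" d] k(3) 2 by (simp add: algebra_simps)
    next
      case (3 t)
      \<comment> \<open>For \<open>n = 11\<close> this case has \<open>t = 3\<close>;
        \<open>attains_deficit\<close> is used with \<open>t + 1\<close>, which is at least
        4.\<close>
      define d where "d = (t + 1) * (t + 1)^2 - k"
      have "Suc n = 3 * (t + 1)" using 3 by simp
      then have "k \<le> (t + 1) * (t + 1) * (t + 1)" using k(2) by (simp only: max_101_simps)
      moreover have "t * (t + 1) * (t + 1) < k" using k(1) 3 by (simp only: max_101_simps)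
      ultimately have "d < (Suc (t + 1))^2" "k = (t + 1) * (t + 1)^2 - d"
        by (simp_all add: d_def power2_eq_square algebra_simps)
      then show ?thesis
        using attains_deficit[of "t + 1" "t + 1" "t + 1" d] k(3) 3 by (simp add: algebra_simps)
    qed
  qed
qed

lemma not_internal_zero_101:
  assumes "7 \<le> n"
  shows "\<not> internal_zero [True, False, True] n"
proof (rule not_internal_zeroI)
  fix w k assume "length w = n" "k < occ [True, False, True] w"
  then have "k \<le> max_101 n" using occ_101_le[of w] by simp
  then show "\<exists>w'. length w' = n \<and> occ [True, False, True] w' = k"
    using attains_le_max_101[OF assms] by (simp add: attains_def)
qed

lemma not_internal_zero_Nil: "\<not> internal_zero [] n"
  unfolding internal_zero_def B_neq_0_iff by auto

lemma not_internal_zero_1: "\<not> internal_zero [True] n"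
proof (rule not_internal_zeroI)
  have occ_1: "occ [True] w = count_list w True" for w
    using occ_replicate_same[of 1 True w] by simp
  fix w k assume "length w = n" "k < occ [True] w"
  then have "k \<le> n" using count_le_length[of w True] by (simp add: occ_1)
  moreover have "count_list (replicate k True @ replicate (n - k) False) True = k"
    by (simp add: count_list_replicate_same count_notin)
  ultimately show "\<exists>w'. length w' = n \<and> occ [True] w' = k"
    unfolding occ_1 by (intro exI[of _ "replicate k True @ replicate (n - k) False"]) simp
qed

section \<open>Words with at most three runs\<close>

text \<open>Only the number of ones matters, so the maximum is \<open>n choose a\<close>, and giving
  up a one costs more than 1 by \<open>gain_one_small\<close>.\<close>

lemma replicate_M_minus_one:
  assumes "2 \<le> a" "a + 2 \<le> n"
  shows "3 \<le> M n (replicate a True)"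
    and "length w = n \<Longrightarrow> Suc (occ (replicate a True) w) \<noteq> M n (replicate a True)"
proof -
  have ge: "n choose a \<le> M n (replicate a True)"
    using occ_le_M[of "replicate a True" "replicate n True"]
    by (simp add: occ_replicate_same count_list_replicate_same)
  have "Suc a choose a \<le> n choose a" using assms by (intro binomial_right_mono) simp
  then have n: "Suc a \<le> n choose a" by simp
  with ge assms show "3 \<le> M n (replicate a True)" by simp
  show "Suc (occ (replicate a True) w) \<noteq> M n (replicate a True)" if "length w = n"
  proof
    define k where "k = count_list w True"
    assume "Suc (occ (replicate a True) w) = M n (replicate a True)"
    then have le: "n choose a \<le> Suc (k choose a)" using ge by (simp add: occ_replicate_same k_def)
    obtain v where "length v = n" "occ (replicate a True) v = M n (replicate a True)"
      using M_attained by blast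
    then have "M n (replicate a True) \<le> n choose a"
      using binomial_right_mono[of "count_list v True" n a] count_le_length[of v True]
      by (simp add: occ_replicate_same)
    then have eq: "Suc (k choose a) = n choose a"
      using le \<open>Suc (occ (replicate a True) w) = _\<close> by (simp add: occ_replicate_same k_def)
    have "k \<noteq> n" using eq by auto
    then have "k < n" using count_le_length[of w True] that by (simp add: k_def)
    then have "Suc k choose a \<le> n choose a" by (intro binomial_right_mono) simp
    then have *: "(Suc k choose a) * 1 \<le> Suc ((k choose a) * 1)" using eq by simp
    have "a \<le> k"
    proof (rule ccontr)
      assume "\<not> a \<le> k"
      then show False using eq n assms(1) by (simp add: binomial_eq_0)
    qed
    from gain_one_small[OF * _ this] show False using assms(1) by simp
  qed
qed

lemma run_split:
  "\<exists>a q. x # p = replicate (Suc a) x @ q \<and> (q = [] \<or> hd q \<noteq> x) \<and> nruns (x # p) = Suc (nruns q)"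
proof (induction p)
  case Nil
  then show ?case by (intro exI[of _ 0] exI[of _ "[]"]) (simp add: nruns_def)
next
  case (Cons y p)
  show ?case
  proof (cases "y = x")
    case True
    with Cons obtain a q where "x # p = replicate (Suc a) x @ q" "q = [] \<or> hd q \<noteq> x" "nruns (x # p) = Suc (nruns q)"
      by auto
    with True show ?thesis by (intro exI[of _ "Suc a"] exI[of _ q]) (auto simp: nruns_def)
  next
    case False
    then show ?thesis by (intro exI[of _ 0] exI[of _ "y # p"]) (simp add: nruns_def)
  qed
qed

lemma nruns_eq_0_iff: "nruns p = 0 \<longleftrightarrow> p = []"
  by (simp add: nruns_def)

text \<open>The second alternative allows \<open>c = 0\<close> and so covers two runs as well as
  three.\<close>

lemma at_most_three_runs:
  assumes "nruns p \<le> 3" "p \<noteq> []" "hd p"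
  obtains a where "1 \<le> a" "p = replicate a True"
  | a b c where "1 \<le> a" "1 \<le> b" "p = three_runs a b c"
proof -
  obtain p' where p': "p = True # p'" using assms(2,3) by (cases p) auto
  obtain a q where q: "p = replicate (Suc a) True @ q" "q = [] \<or> hd q \<noteq> True" "nruns p = Suc (nruns q)"
    using run_split[of True p'] p' by auto
  show ?thesis
  proof (cases q)
    case Nil
    then show ?thesis using q that(1)[of "Suc a"] by simp
  next
    case (Cons y q')
    then have "q = False # q'" using q(2) by auto
    then obtain b s where s: "q = replicate (Suc b) False @ s" "s = [] \<or> hd s \<noteq> False" "nruns q = Suc (nruns s)"
      using run_split[of False q'] by auto
    show ?thesis
    proof (cases s)
      case Nil
      then show ?thesis using q s that(2)[of "Suc a" "Suc b" 0] by (simp add: three_runs_def)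
    next
      case (Cons z s')
      then have "s = True # s'" using s(2) by auto
      then obtain c t where t: "s = replicate (Suc c) True @ t" "nruns s = Suc (nruns t)"
        using run_split[of True s'] by auto
      then have "t = []" using assms(1) q(3) s(3) nruns_eq_0_iff[of t] by simp
      then show ?thesis using q s t that(2)[of "Suc a" "Suc b" "Suc c"] by (simp add: three_runs_def)
    qed
  qed
qed

lemma not_alternating_double: "\<not> alternating (u @ x # x # v)"
  unfolding alternating_def by (auto intro!: exI[of _ "length u"] simp: nth_append)

lemma alternating_replicate_iff:
  assumes "1 \<le> a"
  shows "alternating (replicate a x) \<longleftrightarrow> a = 1"
proof
  assume "alternating (replicate a x)"
  then show "a = 1"
    using not_alternating_double[of "[]" x "replicate (a - 2) x"] assms
    by (cases a; cases "a - 1") auto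
qed (simp add: alternating_def)

lemma alternating_three_runs_iff:
  assumes "1 \<le> a" "1 \<le> b"
  shows "alternating (three_runs a b c) \<longleftrightarrow> a = 1 \<and> b = 1 \<and> c \<le> 1"
proof
  have double: "\<exists>m. k = Suc (Suc m)" if "2 \<le> k" for k
    using that by (metis Suc_le_D numeral_2_eq_2 Suc_le_mono)
  assume alt: "alternating (three_runs a b c)"
  show "a = 1 \<and> b = 1 \<and> c \<le> 1"
  proof (rule ccontr)
    assume "\<not> ?thesis"
    then consider "2 \<le> a" | "2 \<le> b" | "2 \<le> c" using assms by linarith
    then show False
    proof cases
      case 1
      then obtain m where "a = Suc (Suc m)" using double by blast
      then show ?thesis
        using alt not_alternating_double[of "[]" True "replicate m True @ replicate b False @ replicate c True"]
        by (simp add: three_runs_def)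
    next
      case 2
      then obtain m where "b = Suc (Suc m)" using double by blast
      then show ?thesis
        using alt not_alternating_double[of "replicate a True" False "replicate m False @ replicate c True"]
        by (simp add: three_runs_def)
    next
      case 3
      then obtain m where "c = Suc (Suc m)" using double by blast
      then show ?thesis
        using alt not_alternating_double[of "replicate a True @ replicate b False" True "replicate m True"]
        by (simp add: three_runs_def)
    qed
  qed
next
  assume "a = 1 \<and> b = 1 \<and> c \<le> 1"
  then consider "a = 1" "b = 1" "c = 0" | "a = 1" "b = 1" "c = 1" by linarith
  then show "alternating (three_runs a b c)"
    by cases (auto simp: alternating_def three_runs_def nth_Cons less_Suc_eq split: nat.splits)
qed

lemma triv_equiv_1101_iff:
  "triv_equiv p [True, True, False, True] \<longleftrightarrow>
    p \<in> {[True, True, False, True], [True, False, True, True], [False, False, True, False], [False, True, False, False]}"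
proof -
  have "q = compl_word p \<longleftrightarrow> p = compl_word q" for p q
    by (auto simp: compl_word_def comp_def)
  moreover have "q = rev p \<longleftrightarrow> p = rev q" for p q :: "bool list"
    by auto
  ultimately show ?thesis
    unfolding triv_equiv_def by (auto simp: compl_word_def)
qed

text \<open>If the maximum were 0, truncated subtraction would identify \<open>M n p - 1\<close>
  with \<open>M n p\<close>.\<close>

lemma B_M_minus_one_neq_0_iff:
  assumes "0 < M n p"
  shows "B n p (M n p - 1) \<noteq> 0 \<longleftrightarrow> (\<exists>w. length w = n \<and> Suc (occ p w) = M n p)"
  unfolding B_neq_0_iff using assms by (metis Suc_pred' diff_Suc_1)

text \<open>The three conclusions provide the values 0, \<open>M - 1\<close> and \<open>M\<close>
  that form an internal zero, for one run and for several runs alike.\<close>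

lemma not_alternating_gap:
  assumes "nruns p \<le> 3" "p \<noteq> []" "hd p" "\<not> alternating p" and n: "length p + 2 \<le> n"
  shows "3 \<le> M n p" and "\<exists>w. length w = n \<and> occ p w = 0"
    and "length w = n \<Longrightarrow> Suc (occ p w) = M n p \<Longrightarrow>
      n = length p + 2 \<and> p \<in> {[True, True, False, True], [True, False, True, True]}"
proof -
  from at_most_three_runs[OF assms(1-3)]
  have "3 \<le> M n p \<and> (\<exists>w. length w = n \<and> occ p w = 0) \<and> (\<forall>w. length w = n \<longrightarrow> Suc (occ p w) = M n p \<longrightarrow>
      n = length p + 2 \<and> p \<in> {[True, True, False, True], [True, False, True, True]})"
  proof cases
    case (1 a)
    then have a: "2 \<le> a" using assms(4) alternating_replicate_iff[of a True] by auto
    have "occ p (replicate n False) = 0"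
      using 1 a by (simp add: occ_replicate_same count_notin binomial_eq_0)
    then show ?thesis using replicate_M_minus_one[of a n] 1 a n by (metis length_replicate)
  next
    case (2 a b c)
    then have na: "\<not> (a = 1 \<and> b = 1 \<and> c \<le> 1)" and n': "a + b + c + 2 \<le> n"
      using assms(4) alternating_three_runs_iff[of a b c] n by simp_all
    have "occ p (three_runs n 0 0) = 0"
      using 2 occ_three_runs_three_runs[of b a c n 0 0] by simp
    moreover have "3 \<le> M n p" using three_le_M[of a b c n] 2 n' by simp
    moreover have "n = length p + 2 \<and> p \<in> {[True, True, False, True], [True, False, True, True]}"
      if "length w = n" "Suc (occ p w) = M n p" for w
    proof -
      have "b = 1 \<and> n = a + c + 3 \<and> (a = 2 \<and> c = 1 \<or> a = 1 \<and> c = 2)"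
        using occ_eq_M_minus_one_imp[OF 2(1,2) na n' that(1)] that(2) 2(3) by simp
      then show ?thesis using 2(3) by (auto simp: three_runs_def numeral_2_eq_2)
    qed
    ultimately show ?thesis by (intro conjI exI[of _ "three_runs n 0 0"]) auto
  qed
  then show "3 \<le> M n p" "\<exists>w. length w = n \<and> occ p w = 0"
    "length w = n \<Longrightarrow> Suc (occ p w) = M n p \<Longrightarrow>
      n = length p + 2 \<and> p \<in> {[True, True, False, True], [True, False, True, True]}"
    by blast+
qed

text \<open>For length 6 the maximum is \<open>(3 choose 2) * 2 * 1 = 6\<close>, found by checking
  all splittings, while 110101 and 101011 contain the respective word five times.\<close>

lemma B_1101_1011:
  assumes "p \<in> {[True, True, False, True], [True, False, True, True]}"
  shows "B (length p + 2) p (M (length p + 2) p - 1) \<noteq> 0"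
proof -
  have le: "(x choose 2) * y * z \<le> 6" if "x + y + z = 6" for x y z :: nat
  proof -
    have "\<forall>x\<in>{..6}. \<forall>y\<in>{..6}. x + y \<le> 6 \<longrightarrow> (x choose 2) * y * (6 - x - y) \<le> (6 :: nat)"
      by (simp add: atMost_nat_numeral atMost_Suc choose_two)
    moreover have "z = 6 - x - y" "x \<in> {..6}" "y \<in> {..6}" "x + y \<le> 6" using that by auto
    ultimately show ?thesis by blast
  qed
  have 1: "[True, True, False, True] = three_runs 2 1 1" and 2: "[True, False, True, True] = three_runs 1 1 2"
    by (simp_all add: three_runs_def numeral_2_eq_2)
  have "M 6 (three_runs 2 1 1) = 6"
  proof (rule antisym)
    show "M 6 (three_runs 2 1 1) \<le> 6"
      using M_three_runs_attained[of 1 6 2 1] le by (metis choose_one one_neq_zero)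
    show "6 \<le> M 6 (three_runs 2 1 1)"
      using M_ge_three_runs[of 1 3 2 1 6 2 1] by (simp add: choose_two)
  qed
  moreover have "occ [True, True, False, True] [True, True, False, True, False, True] = 5" by simp
  moreover have "M 6 (three_runs 1 1 2) = 6"
  proof (rule antisym)
    obtain x y z where "x + y + z = 6" "(x choose 1) * (y choose 1) * (z choose 2) = M 6 (three_runs 1 1 2)"
      using M_three_runs_attained[of 1 6 1 2] by auto
    then show "M 6 (three_runs 1 1 2) \<le> 6"
      using le[of z y x] by (simp add: ac_simps)
    show "6 \<le> M 6 (three_runs 1 1 2)"
      using M_ge_three_runs[of 1 1 2 3 6 1 2] by (simp add: choose_two)
  qed
  moreover have "occ [True, False, True, True] [True, False, True, False, True, True] = 5" by simp
  ultimately have M: "M 6 p = 6" and w: "\<exists>w. length w = 6 \<and> occ p w = 5"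
    using assms unfolding 1[symmetric] 2[symmetric]
    by (auto intro: exI[of _ "[True, True, False, True, False, True]"]
        exI[of _ "[True, False, True, False, True, True]"])
  have "length p + 2 = 6" using assms by auto
  then show ?thesis using M w unfolding B_neq_0_iff by simp
qed

text \<open>The whole conclusion is made a predicate so that it can be transferred between a word
  and its complement.\<close>

definition gap_dichotomy :: "bool list \<Rightarrow> bool" where
  "gap_dichotomy p \<longleftrightarrow> (alternating p \<longrightarrow> (\<forall>n\<ge>7. \<not> internal_zero p n))
       \<and> (\<not> alternating p \<longrightarrow>
            (\<forall>n\<ge>length p + 3. B n p (M n p - 1) = 0 \<and> internal_zero p n))
       \<and> (\<not> alternating p \<longrightarrow>
            (B (length p + 2) p (M (length p + 2) p - 1) \<noteq> 0
              \<longleftrightarrow> triv_equiv p [True, True, False, True]))"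

lemma gap_dichotomy_hd_True:
  assumes "nruns p \<le> 3" "p = [] \<or> hd p"
  shows "gap_dichotomy p"
proof (cases "alternating p")
  case True
  have "\<not> internal_zero p n" if "7 \<le> n" for n
  proof (cases "p = []")
    case False
    from at_most_three_runs[OF assms(1) False] assms(2) False
    consider a where "1 \<le> a" "p = replicate a True" | a b c where "1 \<le> a" "1 \<le> b" "p = three_runs a b c"
      by metis
    then show ?thesis
    proof cases
      case (1 a)
      then show ?thesis using True alternating_replicate_iff not_internal_zero_1 by simp
    next
      case (2 a b c)
      then have "a = 1" "b = 1" "c = 0 \<or> c = 1" using True alternating_three_runs_iff[of a b c] by auto
      then show ?thesis
        using 2(3) not_internal_zero_10 not_internal_zero_101[OF that] by (auto simp: three_runs_def)
    qed
  qed (simp add: not_internal_zero_Nil)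
  with True show ?thesis by (simp add: gap_dichotomy_def)
next
  case False
  then have p: "p \<noteq> []" "hd p" using assms(2) by (auto simp: alternating_def)
  note gap = not_alternating_gap[OF assms(1) p False]
  have "B n p (M n p - 1) = 0 \<and> internal_zero p n" if "length p + 3 \<le> n" for n
  proof -
    have n: "length p + 2 \<le> n" using that by simp
    have M: "3 \<le> M n p" by (rule gap(1)[OF n])
    have "\<not> (\<exists>w. length w = n \<and> Suc (occ p w) = M n p)" using gap(3)[OF n] that by fastforce
    moreover have "0 < M n p" using M by simp
    ultimately have B: "B n p (M n p - 1) = 0" using B_M_minus_one_neq_0_iff by blast
    have "B n p 0 \<noteq> 0" "B n p (M n p) \<noteq> 0"
      using gap(2)[OF n] M_attained unfolding B_neq_0_iff by blast+
    \<comment> \<open>The values 0, \<open>M n p - 1\<close> and \<open>M n p\<close> are increasing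
      since \<open>M n p\<close> is at least 3.\<close>
    with B have "internal_zero p n"
      unfolding internal_zero_def using M
      by (intro exI[of _ 0] exI[of _ "M n p - 1"] exI[of _ "M n p"]) auto
    with B show ?thesis by blast
  qed
  moreover have "B (length p + 2) p (M (length p + 2) p - 1) \<noteq> 0
    \<longleftrightarrow> triv_equiv p [True, True, False, True]" (is "?B \<longleftrightarrow> ?T")
  proof
    assume ?B
    moreover have "0 < M (length p + 2) p" using gap(1)[OF le_refl] by simp
    ultimately obtain w where "length w = length p + 2" "Suc (occ p w) = M (length p + 2) p"
      using B_M_minus_one_neq_0_iff by blast
    then have "p \<in> {[True, True, False, True], [True, False, True, True]}"
      using gap(3)[OF le_refl] by blast
    then show ?T by (auto simp: triv_equiv_1101_iff)
  next
    assume ?T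
    then have "p \<in> {[True, True, False, True], [True, False, True, True]}"
      using p(2) by (auto simp: triv_equiv_1101_iff)
    then show ?B by (rule B_1101_1011)
  qed
  ultimately show ?thesis using False by (simp add: gap_dichotomy_def)
qed

section \<open>Invariance under complement\<close>

lemma compl_word_compl_word [simp]: "compl_word (compl_word w) = w"
  by (simp add: compl_word_def comp_def)

lemma length_compl_word [simp]: "length (compl_word w) = length w"
  by (simp add: compl_word_def)

lemma occ_compl_left: "occ (compl_word p) w = occ p (compl_word w)"
  using occ_compl[of p "compl_word w"] by simp

lemma B_compl: "B n (compl_word p) k = B n p k"
proof -
  have "bij_betw compl_word {w. length w = n \<and> occ (compl_word p) w = k} {w. length w = n \<and> occ p w = k}"
    by (rule bij_betw_byWitness[where f' = compl_word]) (auto simp: occ_compl_left occ_compl)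
  then show ?thesis unfolding B_def by (rule bij_betw_same_card)
qed

lemma M_compl: "M n (compl_word p) = M n p"
proof -
  have "{occ (compl_word p) w | w. length w = n} = {occ p w | w. length w = n}"
    unfolding occ_compl_left by (metis (no_types, opaque_lifting) compl_word_compl_word length_compl_word)
  then show ?thesis by (simp add: M_def)
qed

lemma gap_dichotomy_compl: "gap_dichotomy (compl_word p) \<longleftrightarrow> gap_dichotomy p"
proof -
  have "alternating (compl_word p) \<longleftrightarrow> alternating p"
    by (auto simp: alternating_def compl_word_def)
  moreover have "internal_zero (compl_word p) n \<longleftrightarrow> internal_zero p n" for n
    by (simp add: internal_zero_def B_compl)
  moreover have "triv_equiv (compl_word p) q \<longleftrightarrow> triv_equiv p q" for q
    by (auto simp: triv_equiv_def compl_word_def rev_map comp_def)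
  ultimately show ?thesis by (simp add: gap_dichotomy_def B_compl M_compl)
qed

theorem mainTheorem14:
  fixes p :: "bool list"
  assumes "nruns p \<le> 3"
  shows "(alternating p \<longrightarrow> (\<forall>n\<ge>7. \<not> internal_zero p n))
       \<and> (\<not> alternating p \<longrightarrow>
            (\<forall>n\<ge>length p + 3. B n p (M n p - 1) = 0 \<and> internal_zero p n))
       \<and> (\<not> alternating p \<longrightarrow>
            (B (length p + 2) p (M (length p + 2) p - 1) \<noteq> 0
              \<longleftrightarrow> triv_equiv p [True, True, False, True]))"
proof -
  have "gap_dichotomy p"
  proof (cases "p = [] \<or> hd p")
    case True
    then show ?thesis using gap_dichotomy_hd_True assms by blast
  next
    case False
    then have "hd (compl_word p)" by (simp add: compl_word_def list.map_sel)
    moreover have "nruns (compl_word p) \<le> 3"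
      using assms remdups_adj_map_injective[of Not p]
      by (simp add: nruns_def compl_word_def inj_def)
    ultimately show ?thesis using gap_dichotomy_hd_True gap_dichotomy_compl by blast
  qed
  then show ?thesis unfolding gap_dichotomy_def .
qed

end
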